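(* Let $G$ be a graph with vertex set $V$. If $G$ has a vertex $v$ such that the induced subgraph of $G$ on $V\setminus\{v\}$ has no $K_4$ minor, then the cut polytope $\mathrm{Cut}^\square(G)$ is normal.
   Context: All graphs are finite, without loops or multiple edges. For a graph $G$ on the vertex set $[n]=\{1,\dots,n\}$ with edge set $E$ and for $S\subset[n]$, let $\delta_G(S)\in\mathbb{R}^E$ be the $0/1$ vector with $\delta_G(S)_{ij}=1$ if $|S\cap\{i,j\}|=1$ and $\delta_G(S)_{ij}=0$ otherwise, for $ij\in E$. Let $A_G=\{\delta_G(S)\mid S\subset[n]\}\subset\mathbb{Z}^E$. The cut polytope $\mathrm{Cut}^\square(G)$ is the convex hull of $A_G$. Let $X_G=\left\{\binom{\mathbf{a}}{1} \mid \mathbf{a}\in A_G\right\}\subset\mathbb{Z}^{E+1}$ (each vector of $A_G$ with an extra last coordinate $1$ appended), and let $\mathbb{Z}(X_G)$, $\mathbb{Q}_+(X_G)$, $\mathbb{Z}_+(X_G)$ denote the sets of all linear combinations of elements of $X_G$ with coefficients that are, respectively, integers, nonnegative rationals, nonnegative integers. The cut polytope $\mathrm{Cut}^\square(G)$ is called normal if $\mathbb{Z}_+(X_G)=\mathbb{Z}(X_G)\cap\mathbb{Q}_+(X_G)$. $K_4$ is the complete graph on 4 vertices. *)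

theory Defs
  imports Complex_Main
begin

section \<open>Finite simple graphs and minors\<close>

text \<open>A graph is given by its vertex set \<open>V\<close> and its set \<open>E\<close> of edges, an edge being a
  two-element subset of \<open>V\<close>.\<close>

definition simple_graph :: "'a set \<Rightarrow> 'a set set \<Rightarrow> bool" where
  "simple_graph V E \<longleftrightarrow> finite V \<and> (\<forall>e\<in>E. e \<subseteq> V \<and> card e = 2)"

definition induced_edges :: "'a set set \<Rightarrow> 'a set \<Rightarrow> 'a set set" where
  "induced_edges E W = {e \<in> E. e \<subseteq> W}"

definition merge_into :: "'a \<Rightarrow> 'a \<Rightarrow> 'a \<Rightarrow> 'a" where
  "merge_into u w x = (if x = w then u else x)"

text \<open>Contracting \<open>{u, w}\<close> identifies \<open>w\<close> with \<open>u\<close>. Since edges are sets, parallel edges are merged;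
  the contracted edge becomes the loop \<open>{u}\<close> and is discarded.\<close>

definition contract_edges :: "'a \<Rightarrow> 'a \<Rightarrow> 'a set set \<Rightarrow> 'a set set" where
  "contract_edges u w E = (\<lambda>e. merge_into u w ` e) ` E - {{u}}"

text \<open>\<open>minor_of V E W F\<close>: the graph \<open>(W, F)\<close> arises from \<open>(V, E)\<close> by a finite sequence of vertex
  deletions, edge deletions and edge contractions.\<close>

inductive minor_of :: "'a set \<Rightarrow> 'a set set \<Rightarrow> 'a set \<Rightarrow> 'a set set \<Rightarrow> bool"
  for V :: "'a set" and E :: "'a set set" where
  refl: "minor_of V E V E"
| delete_vertex:
    "minor_of V E W F \<Longrightarrow> w \<in> W \<Longrightarrow> minor_of V E (W - {w}) (induced_edges F (W - {w}))"
| delete_edge: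
    "minor_of V E W F \<Longrightarrow> e \<in> F \<Longrightarrow> minor_of V E W (F - {e})"
| contract_edge:
    "minor_of V E W F \<Longrightarrow> {u, w} \<in> F \<Longrightarrow> u \<noteq> w \<Longrightarrow>
      minor_of V E (W - {w}) (contract_edges u w F)"

definition is_complete_graph :: "nat \<Rightarrow> 'a set \<Rightarrow> 'a set set \<Rightarrow> bool" where
  "is_complete_graph n W F \<longleftrightarrow> finite W \<and> card W = n \<and> F = {e. e \<subseteq> W \<and> card e = 2}"

definition has_complete_minor :: "nat \<Rightarrow> 'a set \<Rightarrow> 'a set set \<Rightarrow> bool" where
  "has_complete_minor n V E \<longleftrightarrow> (\<exists>W F. minor_of V E W F \<and> is_complete_graph n W F)"

lemma minor_of_simple_graph:
  assumes "minor_of V E W F" "simple_graph V E"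
  shows "simple_graph W F"
  using assms
proof (induction rule: minor_of.induct)
  case (contract_edge W F u w)
  have sg: "simple_graph W F"
    using contract_edge.IH contract_edge.prems by blast
  have uW: "u \<in> W"
    using sg contract_edge.hyps(2) unfolding simple_graph_def by blast
  have "e' \<subseteq> W - {w} \<and> card e' = 2" if e': "e' \<in> contract_edges u w F" for e'
  proof -
    obtain e where e: "e \<in> F" "e' = merge_into u w ` e" and ne: "e' \<noteq> {u}"
      using e' unfolding contract_edges_def by blast
    have "e \<subseteq> W" "card e = 2"
      using sg e(1) unfolding simple_graph_def by blast+
    then obtain x y where xy: "e = {x, y}" "x \<noteq> y" "x \<in> W" "y \<in> W"
      unfolding card_2_iff by blast
    have e'_eq: "e' = {merge_into u w x, merge_into u w y}"
      using e(2) xy(1) by simp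
    moreover have "merge_into u w x \<in> W - {w}" "merge_into u w y \<in> W - {w}"
      using xy uW \<open>u \<noteq> w\<close> by (simp_all add: merge_into_def)
    moreover have "merge_into u w x \<noteq> merge_into u w y"
      using ne e'_eq xy(2) by (simp add: merge_into_def split: if_splits)
    ultimately show ?thesis
      by simp
  qed
  moreover have "finite (W - {w})"
    using sg by (simp add: simple_graph_def)
  ultimately show ?case
    unfolding simple_graph_def by blast
qed (simp_all add: simple_graph_def induced_edges_def)


section \<open>Cut polytopes\<close>

text \<open>Vectors in \<open>\<real>\<^sup>E\<close> are functions on all sets of vertices that vanish outside \<open>E\<close>.\<close>

definition cut_vector :: "'a set set \<Rightarrow> 'a set \<Rightarrow> 'a set \<Rightarrow> real" where
  "cut_vector E S e = (if e \<in> E \<and> card (S \<inter> e) = 1 then 1 else 0)"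

definition cut_vectors :: "'a set \<Rightarrow> 'a set set \<Rightarrow> ('a set \<Rightarrow> real) set" where
  "cut_vectors V E = {cut_vector E S |S. S \<subseteq> V}"

text \<open>The additional last coordinate has index \<open>None\<close>.\<close>

definition homogenize :: "('b \<Rightarrow> real) \<Rightarrow> 'b option \<Rightarrow> real" where
  "homogenize a i = (case i of None \<Rightarrow> 1 | Some e \<Rightarrow> a e)"

definition cut_configuration :: "'a set \<Rightarrow> 'a set set \<Rightarrow> ('a set option \<Rightarrow> real) set" where
  "cut_configuration V E = homogenize ` cut_vectors V E"

text \<open>Linear combinations of the elements of \<open>X\<close> with coefficients in \<open>C\<close>. This is only meaningful for
  finite \<open>X\<close>; \<open>cut_configuration V E\<close> is finite when \<open>V\<close> is.\<close>

definition lin_combs :: "real set \<Rightarrow> ('b \<Rightarrow> real) set \<Rightarrow> ('b \<Rightarrow> real) set" where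
  "lin_combs C X = {\<lambda>i. \<Sum>x\<in>X. c x * x i |c. \<forall>x\<in>X. c x \<in> C}"

text \<open>Normality of the polytope \<open>conv (cut_vectors V E)\<close> is a condition on the homogenized point
  configuration: \<open>\<int>\<^sub>+(X) = \<int>(X) \<inter> \<rat>\<^sub>+(X)\<close>.\<close>

definition normal_cut_polytope :: "'a set \<Rightarrow> 'a set set \<Rightarrow> bool" where
  "normal_cut_polytope V E \<longleftrightarrow>
     (let X = cut_configuration V E
      in lin_combs \<nat> X = lin_combs \<int> X \<inter> lin_combs {q \<in> \<rat>. q \<ge> 0} X)"

lemma finite_cut_configuration: "finite V \<Longrightarrow> finite (cut_configuration V E)"
  by (simp add: cut_configuration_def cut_vectors_def)

end

theory Submission
  imports Defs
begin

text \<open>A lattice point of the cone over the cut polytope at height \<open>k\<close> has to be written as a sum of \<open>k\<close>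
cuts. The argument removes the vertices of the graph other than \<open>v\<close> one at a time.

A nonempty graph without \<open>K\<^sub>4\<close> minor has a vertex \<open>a\<close> of degree at most two, and deleting \<open>a\<close> while joining its
neighbours \<open>b\<close> and \<open>c\<close> by an edge is a contraction, so it creates no \<open>K\<^sub>4\<close> minor
(\<open>degree_2_reduction\<close>). Take such an \<open>a\<close> in the graph without \<open>v\<close>, and suppose that all pairs inside \<open>{v, a, b, c}\<close> carry values. By induction the
values on the graph without \<open>a\<close> come from \<open>k\<close> cuts, that is, from a set \<open>A u \<subseteq> {0..<k}\<close> for every
vertex \<open>u\<close> such that the value of an edge \<open>uw\<close> is the size of the symmetric difference of \<open>A u\<close> and
\<open>A w\<close>; moreover \<open>A v\<close> may be taken empty. It remains to find \<open>A a\<close> with prescribed distances to the three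
sets \<open>A v = {}\<close>, \<open>A b\<close> and \<open>A c\<close>. Up to one integer parameter this fixes how many elements are taken
from each region of the Venn diagram, and the parameter is confined to an interval with integer
ends, nonempty by the triangle inequalities (\<open>exists_subset_with_distances\<close>). This is the point
where integrality costs nothing.

The remaining difficulty is that some of the pairs inside \<open>{v, a, b, c}\<close> need not be edges, so that
their values must be chosen, as integers and with the right parity. This requires knowing exactly
which values are admissible. Admissible vectors are described by the cycle inequalities
\<open>x(F) - x(C - F) \<le> k (|F| - 1)\<close> for cycles \<open>C\<close> and odd \<open>F \<subseteq> C\<close>. Here they are stated
for closed walks: traversing an edge \<open>e\<close> costs either \<open>x e\<close> or \<open>k - x e\<close>, and a closed walk with an odd
number of steps of the second kind must cost at least \<open>k\<close>. In this form, the bounds on the value of a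
new edge \<open>pq\<close> are the costs of walks from \<open>p\<close> to \<open>q\<close>. These are integers, and since all
walks from \<open>p\<close> to \<open>q\<close> with the same parity of steps of the second kind have costs of the same parity,
they lie in the correct residue class (\<open>feasible_value_exists\<close>). Any value
from \<open>0\<close> to \<open>k\<close> within these bounds preserves the inequalities (\<open>feasible_insert\<close>). Membership in the lattice enters
only through a \<open>0/1\<close> labelling of the vertices such that an edge has an odd value if and only if its
ends have different labels, and the
rational cone only through the walk inequalities, which each single cut satisfies.\<close>

section \<open>Complete minors from branch sets\<close>

definition linked :: "'a set set \<Rightarrow> 'a set \<Rightarrow> 'a set \<Rightarrow> bool" where
  "linked E X Y \<longleftrightarrow> (\<exists>x\<in>X. \<exists>y\<in>Y. {x, y} \<in> E)"

text \<open>Connectedness is expressed by cuts rather than by paths: a partition of a contracted set pulls back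
to a partition of the original set, so this form is inherited by contractions without any path
surgery.\<close>

definition connected_in :: "'a set set \<Rightarrow> 'a set \<Rightarrow> bool" where
  "connected_in E B \<longleftrightarrow>
     (\<forall>X Y. X \<union> Y = B \<longrightarrow> X \<inter> Y = {} \<longrightarrow> X \<noteq> {} \<longrightarrow> Y \<noteq> {} \<longrightarrow> linked E X Y)"

definition complete_model :: "nat \<Rightarrow> 'a set \<Rightarrow> 'a set set \<Rightarrow> (nat \<Rightarrow> 'a set) \<Rightarrow> bool" where
  "complete_model n V E B \<longleftrightarrow>
     (\<forall>i<n. B i \<noteq> {} \<and> B i \<subseteq> V \<and> connected_in E (B i)) \<and>
     (\<forall>i<n. \<forall>j<n. i \<noteq> j \<longrightarrow> B i \<inter> B j = {} \<and> linked E (B i) (B j))"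

lemma linked_sym: "linked E X Y \<Longrightarrow> linked E Y X"
  unfolding linked_def by (metis insert_commute)

lemma minor_of_trans:
  assumes "minor_of W F X Y" "minor_of V E W F"
  shows "minor_of V E X Y"
  using assms
proof (induction rule: minor_of.induct)
  case refl then show ?case .
next
  case (delete_vertex X Y w) then show ?case by (intro minor_of.delete_vertex) simp_all
next
  case (delete_edge X Y e) then show ?case by (intro minor_of.delete_edge) simp_all
next
  case (contract_edge X Y u w) then show ?case by (intro minor_of.contract_edge) simp_all
qed

lemma has_complete_minor_mono:
  "minor_of V E W F \<Longrightarrow> has_complete_minor n W F \<Longrightarrow> has_complete_minor n V E"
  unfolding has_complete_minor_def by (blast intro: minor_of_trans)

text \<open>Disjointness of the images guarantees that the image of the linking edge is not the discarded loop.\<close>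

lemma linked_contract:
  assumes "linked E X Y" "merge_into u w ` X \<inter> merge_into u w ` Y = {}"
  shows "linked (contract_edges u w E) (merge_into u w ` X) (merge_into u w ` Y)"
proof -
  obtain x y where xy: "x \<in> X" "y \<in> Y" "{x, y} \<in> E"
    using assms(1) unfolding linked_def by blast
  have "merge_into u w x \<noteq> merge_into u w y"
    using assms(2) xy by blast
  then have "{merge_into u w x, merge_into u w y} \<noteq> {u}"
    by auto
  then have "{merge_into u w x, merge_into u w y} \<in> contract_edges u w E"
    using imageI[OF xy(3), of "\<lambda>e. merge_into u w ` e"] unfolding contract_edges_def by simp
  then show ?thesis
    unfolding linked_def using xy by blast
qed

lemma merge_into_image:
  assumes "u \<in> B \<or> w \<notin> B" "u \<noteq> w"
  shows "merge_into u w ` B = B - {w}"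
proof -
  have "merge_into u w x \<in> B - {w}" if "x \<in> B" for x
    using assms that by (auto simp: merge_into_def)
  moreover have "x \<in> merge_into u w ` B" if "x \<in> B - {w}" for x
    using that by (intro image_eqI[of _ _ x]) (auto simp: merge_into_def)
  ultimately show ?thesis by (intro subset_antisym subsetI) (auto simp del: Diff_iff)
qed

lemma connected_contract:
  assumes B: "connected_in E B" and u: "u \<in> B \<or> w \<notin> B" and "u \<noteq> w"
  shows "connected_in (contract_edges u w E) (B - {w})"
  unfolding connected_in_def
proof (intro allI impI)
  fix X Y
  assume XY: "X \<union> Y = B - {w}" "X \<inter> Y = {}" "X \<noteq> {}" "Y \<noteq> {}"
  \<comment> \<open>Undo the contraction: \<open>w\<close> is put back on the side of \<open>u\<close>.\<close>
  let ?lift = "\<lambda>X. if u \<in> X \<and> w \<in> B then insert w X else X"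
  have w: "w \<notin> X" "w \<notin> Y"
    using XY by auto
  have "linked E (?lift X) (?lift Y)"
  proof -
    have "?lift X \<union> ?lift Y = B" using XY u \<open>u \<noteq> w\<close> by auto
    moreover have "?lift X \<inter> ?lift Y = {}" using XY w by auto
    ultimately show ?thesis using B XY(3,4) unfolding connected_in_def by simp
  qed
  moreover have "merge_into u w ` ?lift Z = Z" if "w \<notin> Z" for Z
    using that \<open>u \<noteq> w\<close> by (subst merge_into_image) auto
  then have "merge_into u w ` ?lift X = X" "merge_into u w ` ?lift Y = Y"
    using w by blast+
  ultimately show "linked (contract_edges u w E) X Y"
    using linked_contract[of E "?lift X" "?lift Y" u w] XY(2) by simp
qed

text \<open>Vertices outside all branch sets are deleted. A branch set with two or more elements contains an
edge, which is contracted. When neither is possible, the graph itself is complete.\<close>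

lemma complete_minor_of_model:
  assumes "simple_graph V E" "complete_model n V E B"
  shows "has_complete_minor n V E"
  using assms
proof (induction "card V" arbitrary: V E B rule: less_induct)
  case less
  have fin: "finite V" using less.prems(1) by (simp add: simple_graph_def)
  have B: "B i \<noteq> {}" "B i \<subseteq> V" "connected_in E (B i)" if "i < n" for i
    using less.prems(2) that unfolding complete_model_def by auto
  have BB: "B i \<inter> B j = {}" "linked E (B i) (B j)" if "i < n" "j < n" "i \<noteq> j" for i j
    using less.prems(2) that unfolding complete_model_def by auto
  consider (spare) w where "w \<in> V" "\<And>i. i < n \<Longrightarrow> w \<notin> B i"
    | (big) i u w where "i < n" "u \<in> B i" "w \<in> B i" "u \<noteq> w"
    | (tight) "V = (\<Union>i<n. B i)" "\<And>i u w. i < n \<Longrightarrow> u \<in> B i \<Longrightarrow> w \<in> B i \<Longrightarrow> u = w"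
  proof (cases "(\<forall>w\<in>V. \<exists>i<n. w \<in> B i) \<and> (\<forall>i<n. \<forall>u\<in>B i. \<forall>w\<in>B i. u = w)")
    case True
    then have "V = (\<Union>i<n. B i)" using B(2) by fast
    then show ?thesis using True tight by blast
  next
    case False
    then show ?thesis using spare big by blast
  qed
  then show ?case
  proof cases
    case spare
    let ?E = "induced_edges E (V - {w})"
    have m: "minor_of V E (V - {w}) ?E"
      by (rule minor_of.delete_vertex[OF minor_of.refl spare(1)])
    have link: "linked ?E X Y" if "linked E X Y" "X \<subseteq> V - {w}" "Y \<subseteq> V - {w}" for X Y
      using that unfolding linked_def induced_edges_def by blast
    have sub: "B i \<subseteq> V - {w}" if "i < n" for i
      using B(2) spare(2) that by blast
    have "complete_model n (V - {w}) ?E B"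
      unfolding complete_model_def connected_in_def
    proof (intro conjI allI impI)
      fix i X Y
      assume i: "i < n" and XY: "X \<union> Y = B i" "X \<inter> Y = {}" "X \<noteq> {}" "Y \<noteq> {}"
      then have "linked E X Y" using B(3)[OF i] by (simp add: connected_in_def)
      moreover have "X \<subseteq> V - {w}" "Y \<subseteq> V - {w}" using sub[OF i] XY(1) by auto
      ultimately show "linked ?E X Y" by (rule link)
    qed (use B BB link sub in auto)
    moreover have "card (V - {w}) < card V"
      using fin spare(1) by (meson card_Diff1_less)
    ultimately have "has_complete_minor n (V - {w}) ?E"
      using less.hyps minor_of_simple_graph[OF m less.prems(1)] by blast
    then show ?thesis using m has_complete_minor_mono by blast
  next
    case (big i u0 w)
    have "linked E {w} (B i - {w})"
    proof -
      have "{w} \<union> (B i - {w}) = B i" "{w} \<inter> (B i - {w}) = {}" "B i - {w} \<noteq> {}"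
        using big by auto
      then show ?thesis using B(3)[OF big(1)] unfolding connected_in_def by blast
    qed
    then obtain u where u: "u \<in> B i" "u \<noteq> w" "{u, w} \<in> E"
      unfolding linked_def by (auto simp: insert_commute)
    let ?E = "contract_edges u w E"
    have m: "minor_of V E (V - {w}) ?E"
      by (rule minor_of.contract_edge[OF minor_of.refl u(3) u(2)])
    have uw: "u \<in> B j \<or> w \<notin> B j" if "j < n" for j
      using BB(1)[of i j] big u that by (cases "i = j") auto
    have img: "merge_into u w ` B j = B j - {w}" if "j < n" for j
      using merge_into_image uw u(2) that by metis
    have "complete_model n (V - {w}) ?E (\<lambda>j. B j - {w})"
      unfolding complete_model_def
    proof (intro conjI allI impI)
      fix j assume j: "j < n"
      show "B j - {w} \<noteq> {}" using B(1) uw u(2) j by fastforce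
      show "B j - {w} \<subseteq> V - {w}" using B(2) j by blast
      show "connected_in ?E (B j - {w})"
        using connected_contract B(3) uw u(2) j by metis
    next
      fix j l assume jl: "j < n" "l < n" "j \<noteq> l"
      show "(B j - {w}) \<inter> (B l - {w}) = {}" using BB(1) jl by blast
      then show "linked ?E (B j - {w}) (B l - {w})"
        using linked_contract[OF BB(2), of j l u w] img jl by simp
    qed
    moreover have "card (V - {w}) < card V"
      using fin B(2) big by (meson card_Diff1_less subsetD)
    ultimately have "has_complete_minor n (V - {w}) ?E"
      using less.hyps minor_of_simple_graph[OF m less.prems(1)] by blast
    then show ?thesis using m has_complete_minor_mono by blast
  next
    case tight
    have "\<forall>i<n. \<exists>b. B i = {b}"
      using B(1) tight(2) by blast
    then obtain b where b: "\<And>i. i < n \<Longrightarrow> B i = {b i}" by metis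
    have V: "V = b ` {..<n}" using tight(1) b by auto
    have inj: "inj_on b {..<n}"
      using BB(1) b by (auto simp: inj_on_def)
    have "e \<in> E" if e: "e \<subseteq> V" "card e = 2" for e
    proof -
      obtain x y where xy: "e = {x, y}" "x \<noteq> y" using e(2) by (auto simp: card_2_iff)
      then obtain i j where "i < n" "j < n" "x = b i" "y = b j" using e(1) V by auto
      then show ?thesis using BB(2)[of i j] b xy unfolding linked_def by auto
    qed
    then have "E = {e. e \<subseteq> V \<and> card e = 2}"
      using less.prems(1) unfolding simple_graph_def by blast
    moreover have "card V = n" using V card_image[OF inj] by simp
    ultimately have "is_complete_graph n V E"
      using fin unfolding is_complete_graph_def by blast
    then show ?thesis
      unfolding has_complete_minor_def using minor_of.refl by blast
  qed
qed

section \<open>Vertices of degree at most two in graphs without a K4 minor\<close>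

definition nbrs :: "'a set set \<Rightarrow> 'a \<Rightarrow> 'a set" where
  "nbrs E x = {y. {x, y} \<in> E}"

definition is_path :: "'a set \<Rightarrow> 'a set set \<Rightarrow> 'a list \<Rightarrow> bool" where
  "is_path V E p \<longleftrightarrow> distinct p \<and> set p \<subseteq> V \<and> successively (\<lambda>x y. {x, y} \<in> E) p"

lemma connected_interval:
  assumes "successively (\<lambda>x y. {x, y} \<in> E) p" "b \<le> length p"
  shows "connected_in E ((!) p ` {a..<b})"
  unfolding connected_in_def
proof (intro allI impI)
  fix X Y
  assume XY: "X \<union> Y = (!) p ` {a..<b}" "X \<inter> Y = {}" "X \<noteq> {}" "Y \<noteq> {}"
  have step: "{p ! i, p ! Suc i} \<in> E" if "Suc i < b" for i
    using assms that by (simp add: successively_conv_nth)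
  have one_side: "p ! j \<in> Z" if Z: "p ! i \<in> Z" "Z \<union> Z' = (!) p ` {a..<b}" "\<not> linked E Z Z'"
    and ij: "a \<le> i" "i \<le> j" "j < b" for i j Z Z'
    using ij(2,3,1)
  proof (induction j rule: dec_induct)
    case base then show ?case using Z by simp
  next
    case (step m)
    have "p ! m \<in> Z" using step by simp
    moreover have "p ! Suc m \<in> Z \<union> Z'" using step Z(2) by auto
    ultimately show ?case
      using \<open>\<And>i. Suc i < b \<Longrightarrow> {p ! i, p ! Suc i} \<in> E\<close> step Z(3) unfolding linked_def by blast
  qed
  show "linked E X Y"
  proof (rule ccontr)
    assume n: "\<not> linked E X Y"
    obtain x y where xy: "x \<in> X" "y \<in> Y" using XY(3,4) by blast
    then have "x \<in> (!) p ` {a..<b}" "y \<in> (!) p ` {a..<b}" using XY(1) by blast+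
    then obtain i j where ij: "a \<le> i" "i < b" "p ! i \<in> X" "a \<le> j" "j < b" "p ! j \<in> Y"
      using xy by auto
    have "\<not> linked E Y X" using n linked_sym by blast
    then have "p ! j \<in> X \<or> p ! i \<in> Y"
      using one_side[of i X Y j] one_side[of j Y X i] n ij XY(1) by (metis Un_commute nat_le_linear)
    then show False using ij XY(2) by blast
  qed
qed

text \<open>An edge from the first vertex of a path to a later vertex \<open>p ! i\<close> turns the path into another one
with the same vertices that starts at \<open>p ! (i - 1)\<close>.\<close>

lemma rotated_path:
  assumes p: "is_path V E p" and i: "0 < i" "i < length p" "{p ! 0, p ! i} \<in> E"
  shows "is_path V E (rev (take i p) @ drop i p)"
proof -
  let ?R = "\<lambda>x y. {x, y} \<in> E"
  have "successively ?R (take i p @ drop i p)"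
    using p by (simp add: is_path_def)
  then have "successively ?R (take i p)" "successively ?R (drop i p)"
    unfolding successively_append_iff by blast+
  moreover have "successively ?R (rev (take i p)) = successively ?R (take i p)"
    unfolding successively_rev by (simp add: insert_commute)
  moreover have "last (rev (take i p)) = p ! 0" "hd (drop i p) = p ! i"
    using i by (cases p; simp add: last_rev hd_drop_conv_nth)+
  ultimately have "successively ?R (rev (take i p) @ drop i p)"
    using i by (simp add: successively_append_iff)
  moreover have "distinct (rev (take i p) @ drop i p)"
    using p unfolding is_path_def
    by (metis append_take_drop_id distinct_append distinct_rev set_rev)
  moreover have "set (rev (take i p) @ drop i p) = set p"
    by (metis append_take_drop_id set_append set_rev)
  ultimately show ?thesis using p unfolding is_path_def by simp
qed

text \<open>Along the path from \<open>0\<close> to the larger of \<open>j\<close> and \<open>m\<close>, the branch sets are the intervals that start at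
\<open>0\<close>, \<open>1\<close>, \<open>i\<close> and \<open>min j m\<close>. Consecutive intervals are linked by the path, the first interval is linked to
the third and fourth by the chords \<open>0 i\<close> and \<open>0 j\<close>, and the second to the fourth by the chord from
\<open>i - 1\<close> to \<open>m\<close>.\<close>
lemma K4_minor_of_chords:
  assumes sg: "simple_graph V E" and p: "is_path V E p"
    and i: "2 \<le> i" "i < j" "j < length p" "i < m" "m < length p"
    and e: "{p ! 0, p ! i} \<in> E" "{p ! 0, p ! j} \<in> E" "{p ! (i - 1), p ! m} \<in> E"
  shows "has_complete_minor 4 V E"
proof -
  let ?cut = "min j m"
  define lo where "lo = (!) [0, 1, i, min j m]"
  define hi where "hi = (!) [1, i, min j m, Suc (max j m)]"
  define B where "B n = (!) p ` {lo n..<hi n}" for n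
  note lohi = lo_def hi_def
  have four: "n = 0 \<or> n = 1 \<or> n = 2 \<or> n = 3" if "n < 4" for n :: nat using that by auto
  have bounds: "lo n < hi n" "hi n \<le> length p" if "n < 4" for n
    using four[OF that] i by (auto simp: lohi)
  have sep: "hi n \<le> lo n'" if "n < n'" "n' < 4" for n n'
    using four[of n] four[of n'] that i by (auto simp: lohi)
  have dist: "distinct p" and succ: "successively (\<lambda>x y. {x, y} \<in> E) p" and pV: "set p \<subseteq> V"
    using p by (auto simp: is_path_def)
  have disj: "B n \<inter> B n' = {}" if "n < n'" "n' < 4" for n n'
  proof -
    have "{lo n..<hi n} \<inter> {lo n'..<hi n'} = {}" using sep that by fastforce
    moreover have "inj_on ((!) p) ({lo n..<hi n} \<union> {lo n'..<hi n'})"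
      using dist bounds(2)[of n] bounds(2)[of n'] that
      by (auto intro!: inj_onI simp: nth_eq_iff_index_eq)
    ultimately show ?thesis unfolding B_def
      by (metis image_empty inj_on_image_Int sup_ge1 sup_ge2)
  qed
  have step: "{p ! q, p ! Suc q} \<in> E" if "Suc q < length p" for q
    using succ that by (simp add: successively_conv_nth)
  have link: "linked E (B n) (B n')" if "{p ! q, p ! q'} \<in> E" "lo n \<le> q" "q < hi n" "lo n' \<le> q'" "q' < hi n'" for n n' q q'
    using that unfolding B_def linked_def by fastforce
  have l01: "linked E (B 0) (B 1)" using link[of 0 1 0 1] step[of 0] i by (simp add: lohi)
  have l02: "linked E (B 0) (B 2)" using link[of 0 i 0 2] e i by (simp add: lohi)
  have l03: "linked E (B 0) (B 3)" using link[of 0 j 0 3] e i by (simp add: lohi)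
  have l12: "linked E (B 1) (B 2)" using link[of "i - 1" i 1 2] step[of "i - 1"] i by (simp add: lohi)
  have l13: "linked E (B 1) (B 3)" using link[of "i - 1" m 1 3] e i by (simp add: lohi)
  have l23: "linked E (B 2) (B 3)"
  proof (rule link[of "?cut - 1" ?cut])
    have "Suc (?cut - 1) = ?cut" using i by simp
    then show "{p ! (?cut - 1), p ! ?cut} \<in> E" using step[of "?cut - 1"] i by simp
  qed (use i in \<open>auto simp: lohi\<close>)
  have links: "linked E (B n) (B n')" if "n < n'" "n' < 4" for n n'
  proof -
    have "n = 0 \<and> n' = 1 \<or> n = 0 \<and> n' = 2 \<or> n = 0 \<and> n' = 3 \<or>
        n = 1 \<and> n' = 2 \<or> n = 1 \<and> n' = 3 \<or> n = 2 \<and> n' = 3"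
      using that by linarith
    then show ?thesis using l01 l02 l03 l12 l13 l23 by (elim disjE) simp_all
  qed
  have "complete_model 4 V E B"
    unfolding complete_model_def
  proof (intro conjI allI impI)
    fix n :: nat assume n: "n < 4"
    show "B n \<noteq> {}" using bounds(1)[OF n] by (simp add: B_def)
    show "B n \<subseteq> V" using bounds(2)[OF n] pV by (force simp: B_def)
    show "connected_in E (B n)" unfolding B_def using connected_interval succ bounds(2) n by blast
  next
    fix n n' :: nat assume n: "n < 4" "n' < 4" "n \<noteq> n'"
    show "B n \<inter> B n' = {}" using disj n by (metis Int_commute nat_neq_iff)
    show "linked E (B n) (B n')" using links linked_sym n by (metis nat_neq_iff)
  qed
  then show ?thesis using complete_minor_of_model sg by blast
qed

text \<open>Every neighbour of the first vertex of a longest path lies on the path. Among all longest paths,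
choose one whose first vertex has a chord to a position \<open>i \<ge> 2\<close> with \<open>i\<close> as small as possible. A third
neighbour of that vertex gives a chord to some \<open>j > i\<close>. The rotated path, which starts at position \<open>i - 1\<close>,
is a longest path as well, and agrees with the old one from \<open>i\<close> onwards. A third neighbour of its first
vertex sits at position at least \<open>i\<close> by minimality, so it gives a chord from \<open>i - 1\<close> to some \<open>m > i\<close>.\<close>

lemma K4_minor_of_min_degree_3:
  assumes sg: "simple_graph V E" and "V \<noteq> {}" and deg: "\<And>x. x \<in> V \<Longrightarrow> 3 \<le> card (nbrs E x)"
  shows "has_complete_minor 4 V E"
proof -
  have fin: "finite V" using sg by (simp add: simple_graph_def)
  define longest where
    "longest p \<longleftrightarrow> is_path V E p \<and> p \<noteq> [] \<and> (\<forall>q. is_path V E q \<longrightarrow> length q \<le> length p)" for p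
  have nbr: "y \<in> V \<and> y \<noteq> x" if "y \<in> nbrs E x" for x y
    using sg that unfolding simple_graph_def nbrs_def by fastforce
  obtain x where "x \<in> V" using \<open>V \<noteq> {}\<close> by blast
  then have x: "is_path V E [x]" by (simp add: is_path_def)
  have "length q < Suc (card V)" if "is_path V E q" for q
    using that fin unfolding is_path_def by (metis card_mono distinct_card le_imp_less_Suc)
  then obtain p0 where "is_path V E p0" "\<forall>q. is_path V E q \<longrightarrow> length q \<le> length p0"
    using ex_has_greatest_nat[of "is_path V E" "[x]" length "Suc (card V)"] x by (metis less_imp_le)
  then have p0: "longest p0"
    unfolding longest_def using x by fastforce
  \<comment> \<open>Two forbidden positions never exhaust the neighbours of the first vertex.\<close>
  have third: "\<exists>t<length p. {p ! 0, p ! t} \<in> E \<and> t \<noteq> 0 \<and> t \<noteq> a \<and> t \<noteq> b" if p: "longest p" for p a b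
  proof -
    have ne: "p \<noteq> []" "is_path V E p" using p by (auto simp: longest_def)
    then have "p ! 0 \<in> V" by (auto simp: is_path_def)
    then have "3 \<le> card (nbrs E (p ! 0))" using deg by blast
    moreover have "card {p ! a, p ! b} \<le> 2" by (simp add: card_insert_if)
    ultimately have "\<not> nbrs E (p ! 0) \<subseteq> {p ! a, p ! b}"
      using card_mono[of "{p ! a, p ! b}" "nbrs E (p ! 0)"] by auto
    then obtain y where y: "y \<in> nbrs E (p ! 0)" "y \<noteq> p ! a" "y \<noteq> p ! b" by blast
    have "y \<in> set p"
    proof (rule ccontr)
      assume "y \<notin> set p"
      then have "is_path V E (y # p)"
        using ne y nbr unfolding is_path_def successively_Cons nbrs_def
        by (simp add: hd_conv_nth insert_commute)
      then show False using p unfolding longest_def by fastforce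
    qed
    then obtain t where "t < length p" "p ! t = y" by (auto simp: in_set_conv_nth)
    moreover from this have "t \<noteq> 0" using nbr[OF y(1)] by metis
    ultimately show ?thesis using y unfolding nbrs_def by auto
  qed
  define chord where "chord i \<longleftrightarrow> (\<exists>p. longest p \<and> 2 \<le> i \<and> i < length p \<and> {p ! 0, p ! i} \<in> E)" for i
  have "\<exists>i. chord i"
  proof -
    obtain t where "t < length p0" "{p0 ! 0, p0 ! t} \<in> E" "t \<noteq> 0" "t \<noteq> 1"
      using third[OF p0, of 1 1] by blast
    then have "chord t" unfolding chord_def using p0 by (intro exI[of _ p0]) auto
    then show ?thesis by (rule exI)
  qed
  define i where "i = (LEAST i. chord i)"
  have i: "chord i" using \<open>\<exists>i. chord i\<close> unfolding i_def by (rule LeastI_ex)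
  have least: "i \<le> t" if "chord t" for t using that unfolding i_def by (rule Least_le)
  obtain p where p: "longest p" "2 \<le> i" "i < length p" "{p ! 0, p ! i} \<in> E"
    using i unfolding chord_def by (elim exE conjE) (rule that)
  have path: "is_path V E p" using p by (simp add: longest_def)
  obtain j where j: "j < length p" "{p ! 0, p ! j} \<in> E" "j \<noteq> 0" "j \<noteq> 1" "j \<noteq> i"
    using third[OF p(1), of 1 i] by blast
  have "chord j" unfolding chord_def using p(1) j by (intro exI[of _ p]) auto
  then have ij: "i < j" using least j(5) by fastforce
  define q where "q = rev (take i p) @ drop i p"
  have len: "length q = length p" using p(3) by (simp add: q_def)
  have q: "longest q"
    using rotated_path[OF path _ p(3,4)] p len unfolding longest_def q_def[symmetric] by auto
  have q_lo: "q ! t = p ! (i - 1 - t)" if "t < i" for t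
    using that p(3) by (simp add: q_def nth_append rev_nth)
  have q_hi: "q ! t = p ! t" if "i \<le> t" "t < length p" for t
    using that p(3) by (simp add: q_def nth_append)
  obtain m where m: "m < length q" "{q ! 0, q ! m} \<in> E" "m \<noteq> 0" "m \<noteq> 1" "m \<noteq> i"
    using third[OF q, of 1 i] by blast
  have "chord m" unfolding chord_def using q m by (intro exI[of _ q]) auto
  then have im: "i < m" using least m(5) by fastforce
  have "{p ! (i - 1), p ! m} \<in> E"
    using m im len q_lo[of 0] q_hi[of m] p(2) by simp
  then show ?thesis
    using K4_minor_of_chords[OF sg path p(2) ij j(1) im] m(1) len p(4) j(2) by simp
qed

text \<open>If \<open>a\<close> has two neighbours \<open>b\<close> and \<open>c\<close>, joining them after removing \<open>a\<close> has the same effect as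
contracting the edge \<open>ab\<close>. With fewer neighbours there is nothing to join, and \<open>a\<close> is just deleted.\<close>

lemma degree_2_reduction:
  assumes sg: "simple_graph V E" and "V \<noteq> {}" and free: "\<not> has_complete_minor 4 V E"
  obtains a N where "a \<in> V" "N \<subseteq> V - {a}" "nbrs E a = N" "card N \<le> 2"
    "\<not> has_complete_minor 4 (V - {a}) (induced_edges E (V - {a}) \<union> {e. e \<subseteq> N \<and> card e = 2})"
proof -
  have fin: "finite V" using sg by (simp add: simple_graph_def)
  obtain a where a: "a \<in> V" "card (nbrs E a) \<le> 2"
    using K4_minor_of_min_degree_3[OF sg \<open>V \<noteq> {}\<close>] free by force
  define N where "N = nbrs E a"
  have N: "N \<subseteq> V - {a}"
    using sg unfolding simple_graph_def N_def nbrs_def by fastforce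
  then have finN: "finite N" using fin by (meson finite_Diff finite_subset)
  have edges: "induced_edges E (V - {a}) \<union> {insert a {x} |x. x \<in> N} = E"
  proof -
    have "\<exists>x. e = {a, x} \<and> {a, x} \<in> E" if "e \<in> E" "a \<in> e" for e
    proof -
      have "card e = 2" using sg that(1) by (simp add: simple_graph_def)
      then obtain y z where yz: "e = {y, z}" unfolding card_2_iff by (elim exE conjE)
      then have "e = {a, y} \<or> e = {a, z}" using that(2) by (auto simp: insert_commute)
      then show ?thesis using that(1) by (elim disjE) blast+
    qed
    then have "E \<subseteq> induced_edges E (V - {a}) \<union> {insert a {x} |x. x \<in> N}"
      using sg unfolding simple_graph_def induced_edges_def N_def nbrs_def by auto
    moreover have "induced_edges E (V - {a}) \<union> {insert a {x} |x. x \<in> N} \<subseteq> E"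
      unfolding induced_edges_def N_def nbrs_def by auto
    ultimately show ?thesis by (rule subset_antisym[rotated])
  qed
  have "\<not> has_complete_minor 4 (V - {a}) (induced_edges E (V - {a}) \<union> {e. e \<subseteq> N \<and> card e = 2})"
  proof (cases "card N = 2")
    case False
    have "card e \<noteq> 2" if "e \<subseteq> N" for e
      using a(2) card_mono[OF finN that] False unfolding N_def[symmetric] by linarith
    then have no_pair: "{e. e \<subseteq> N \<and> card e = 2} = {}" by blast
    show ?thesis unfolding no_pair
      using free has_complete_minor_mono[OF minor_of.delete_vertex[OF minor_of.refl a(1)]] by auto
  next
    case True
    then obtain b c where bc: "N = {b, c}" "b \<noteq> c" by (auto simp: card_2_iff)
    have ne: "b \<noteq> a" "c \<noteq> a" using N bc by auto
    have ba: "{b, a} \<in> E" using bc unfolding N_def nbrs_def by (auto simp: insert_commute)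
    have "{e. e \<subseteq> N \<and> card e = 2} = {{b, c}}"
    proof -
      have "e = {b, c}" if "e \<subseteq> {b, c}" "card e = 2" for e
        using that bc by (intro card_subset_eq) auto
      moreover have "card {b, c} = 2" using bc(2) by simp
      ultimately show ?thesis unfolding bc(1) by blast
    qed
    moreover have "contract_edges b a E = induced_edges E (V - {a}) \<union> {{b, c}}"
    proof -
      let ?m = "\<lambda>e. merge_into b a ` e"
      have unmoved: "?m e = e" if "a \<notin> e" for e
        using merge_into_image[of b e a] ne(1) that by simp
      have ind: "a \<notin> e \<and> e \<noteq> {b}" if "e \<in> induced_edges E (V - {a})" for e
        using that sg unfolding induced_edges_def simple_graph_def by auto
      have "E = induced_edges E (V - {a}) \<union> {{a, b}, {a, c}}"
        using edges unfolding bc(1) by blast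
      then have "?m ` E = ?m ` induced_edges E (V - {a}) \<union> ?m ` {{a, b}, {a, c}}"
        by (metis image_Un)
      also have "?m ` induced_edges E (V - {a}) = induced_edges E (V - {a})"
        using ind unmoved by (simp cong: image_cong)
      also have "?m ` {{a, b}, {a, c}} = {{b}, {b, c}}"
        using ne by (auto simp: merge_into_def)
      finally have img: "?m ` E = induced_edges E (V - {a}) \<union> {{b}, {b, c}}" .
      have "{b} \<notin> induced_edges E (V - {a})" using ind by blast
      then show ?thesis unfolding contract_edges_def img using bc(2) by auto
    qed
    ultimately show ?thesis
      using free has_complete_minor_mono[OF minor_of.contract_edge[OF minor_of.refl ba ne(1)]] by auto
  qed
  then show ?thesis using that[of a N] a N N_def by blast
qed

section \<open>Cycle inequalities as signed walks\<close>

definition step_cost :: "('a set \<Rightarrow> int) \<Rightarrow> int \<Rightarrow> bool \<Rightarrow> 'a set \<Rightarrow> int" where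
  "step_cost x k s e = (if s then k - x e else x e)"

text \<open>\<open>signed_walk E x k u w b l\<close>: there is a walk from \<open>u\<close> to \<open>w\<close> of total cost \<open>l\<close>, in which every step is
charged either \<open>x e\<close> or \<open>k - x e\<close>, and \<open>b\<close> tells whether the number of steps of the second kind is odd.
Equivalently, this is a walk in the double cover of the graph, with \<open>b\<close> recording a change of sheet.\<close>

inductive signed_walk ::
  "'a set set \<Rightarrow> ('a set \<Rightarrow> int) \<Rightarrow> int \<Rightarrow> 'a \<Rightarrow> 'a \<Rightarrow> bool \<Rightarrow> int \<Rightarrow> bool"
  for E x k where
  Nil: "signed_walk E x k u u False 0"
| Cons: "{u, w} \<in> E \<Longrightarrow> signed_walk E x k w z b l \<Longrightarrow>
    signed_walk E x k u z (s \<noteq> b) (step_cost x k s {u, w} + l)"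

text \<open>This expresses that \<open>x\<close> is congruent to a cut modulo 2, which characterizes the integer vectors in the lattice
generated by the cut vectors.\<close>

definition potential :: "'a set set \<Rightarrow> ('a set \<Rightarrow> int) \<Rightarrow> ('a \<Rightarrow> bool) \<Rightarrow> bool" where
  "potential E x \<pi> \<longleftrightarrow> (\<forall>u w. {u, w} \<in> E \<longrightarrow> odd (x {u, w}) = (\<pi> u \<noteq> \<pi> w))"

text \<open>These are the bounds and cycle inequalities for the dilated polytope: when \<open>F\<close> is the odd set of
edges charged \<open>k - x e\<close> in a cycle \<open>C\<close>, the cost of going round \<open>C\<close> is \<open>k |F| - x(F) + x(C - F)\<close>.
Closed walks instead of cycles make concatenation available.\<close>

definition feasible :: "'a set set \<Rightarrow> ('a set \<Rightarrow> int) \<Rightarrow> int \<Rightarrow> bool" where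
  "feasible E x k \<longleftrightarrow> (\<forall>e\<in>E. 0 \<le> x e \<and> x e \<le> k) \<and>
     (\<forall>u l. signed_walk E x k u u True l \<longrightarrow> k \<le> l)"

lemma signed_walk_append:
  assumes "signed_walk E x k u w b l" "signed_walk E x k w z b' l'"
  shows "signed_walk E x k u z (b \<noteq> b') (l + l')"
  using assms
proof (induction rule: signed_walk.induct)
  case (Nil u) then show ?case by simp
next
  case (Cons u w y b l s)
  have "signed_walk E x k u z (s \<noteq> (b \<noteq> b')) (step_cost x k s {u, w} + (l + l'))"
    using Cons by (intro signed_walk.Cons) auto
  moreover have "(s \<noteq> (b \<noteq> b')) = ((s \<noteq> b) \<noteq> b')" by auto
  ultimately show ?case by (simp only: add.assoc)
qed

lemma signed_walk_single:
  "{u, w} \<in> E \<Longrightarrow> signed_walk E x k u w s (step_cost x k s {u, w})"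
  using signed_walk.Cons[OF _ signed_walk.Nil, of u w E x k s] by simp

lemma signed_walk_rev:
  assumes "signed_walk E x k u w b l"
  shows "signed_walk E x k w u b l"
  using assms
proof (induction rule: signed_walk.induct)
  case (Nil u) then show ?case by (rule signed_walk.Nil)
next
  case (Cons u w y b l s)
  have "signed_walk E x k w u s (step_cost x k s {u, w})"
    using signed_walk_single[of w u E x k s] Cons by (simp add: insert_commute)
  from signed_walk_append[OF Cons.IH this]
  have "signed_walk E x k y u (b \<noteq> s) (l + step_cost x k s {u, w})" .
  moreover have "(b \<noteq> s) = (s \<noteq> b)" by auto
  ultimately show ?case by (simp only: add.commute)
qed

lemma signed_walk_mono:
  assumes "signed_walk E x k u w b l" "E \<subseteq> E'" "\<And>e. e \<in> E \<Longrightarrow> x e = x' e"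
  shows "signed_walk E' x' k u w b l"
  using assms
proof (induction rule: signed_walk.induct)
  case (Nil u) then show ?case by (intro signed_walk.Nil)
next
  case (Cons u w y b l s)
  have "signed_walk E' x' k u y (s \<noteq> b) (step_cost x' k s {u, w} + l)"
    using Cons by (intro signed_walk.Cons) auto
  moreover have "step_cost x' k s {u, w} = step_cost x k s {u, w}"
    using Cons unfolding step_cost_def by simp
  ultimately show ?case by simp
qed

lemma step_cost_nonneg:
  "feasible E x k \<Longrightarrow> e \<in> E \<Longrightarrow> 0 \<le> step_cost x k s e"
  by (auto simp: feasible_def step_cost_def)

lemma signed_walk_nonneg:
  assumes "signed_walk E x k u w b l" "feasible E x k"
  shows "0 \<le> l"
  using assms by (induction rule: signed_walk.induct) (auto intro: add_nonneg_nonneg step_cost_nonneg)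

text \<open>The parity of the cost of a walk depends only on its ends and its sign. This is why extremal walk
costs are always values in the correct residue class.\<close>

lemma signed_walk_parity:
  assumes "signed_walk E x k u w b l" "potential E x \<pi>"
  shows "odd l = ((\<pi> u \<noteq> \<pi> w) \<noteq> (b \<and> odd k))"
  using assms by (induction rule: signed_walk.induct) (auto simp: potential_def step_cost_def)

lemma feasible_subset:
  "feasible E' x k \<Longrightarrow> E \<subseteq> E' \<Longrightarrow> feasible E x k"
  unfolding feasible_def using signed_walk_mono[of E x k _ _ _ _ E' x] by blast

lemma feasible_triangle:
  assumes f: "feasible E x k" and E: "{a, b} \<in> E" "{b, c} \<in> E" "{a, c} \<in> E"
  shows "x {a, c} \<le> x {a, b} + x {b, c}" "x {a, b} + x {b, c} + x {a, c} \<le> 2 * k"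
proof -
  have ca: "{c, a} \<in> E" "x {c, a} = x {a, c}" using E by (simp_all add: insert_commute)
  have w: "signed_walk E x k a a (s \<noteq> (t \<noteq> (r \<noteq> False)))
    (step_cost x k s {a, b} + (step_cost x k t {b, c} + (step_cost x k r {c, a} + 0)))" for s t r
    by (intro signed_walk.intros E ca(1))
  have g: "k \<le> l" if "signed_walk E x k a a True l" for l using f that by (simp add: feasible_def)
  show "x {a, c} \<le> x {a, b} + x {b, c}"
    using g[of "x {a, b} + (x {b, c} + (k - x {a, c}))"] w[of False False True] ca by (simp add: step_cost_def)
  show "x {a, b} + x {b, c} + x {a, c} \<le> 2 * k"
    using g[of "k - x {a, b} + (k - x {b, c} + (k - x {a, c}))"] w[of True True True] ca by (simp add: step_cost_def)
qed

text \<open>A walk in the extended graph that uses the new edge more than once can be shortened: two uses of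
different kinds cost \<open>k\<close> together, two uses of the same kind in the same direction enclose a piece that can be
reversed to bypass both of them, and two uses of the same kind in opposite directions enclose a closed walk, which can be
cut out if it is even and costs at least \<open>k\<close> if it is odd. Hence every walk either costs at least \<open>k\<close> or is
no cheaper than a walk with the same ends and sign that uses the new edge at most once, and for
closed walks of the latter kind the bounds on \<open>c\<close> apply.\<close>

lemma feasible_insert:
  fixes E :: "'a set set"
  assumes f: "feasible E x k" and c: "0 \<le> c" "c \<le> k"
    and even: "\<And>l. signed_walk E x k p q False l \<Longrightarrow> c \<le> l"
    and odd: "\<And>l. signed_walk E x k p q True l \<Longrightarrow> k - c \<le> l"
    and new: "{p, q} \<notin> E"
  shows "feasible (insert {p, q} E) (x({p, q} := c)) k"
proof -
  let ?E = "insert {p, q} E" and ?x = "x({p, q} := c)"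
  let ?W = "signed_walk E x k"
  define cost where "cost s = (if s then k - c else c)" for s
  have cost: "step_cost ?x k s {p, q} = cost s" for s by (simp add: step_cost_def cost_def)
  have old: "step_cost ?x k s e = step_cost x k s e" if "e \<in> E" for s e
    using that new by (auto simp: step_cost_def)
  have cost_nn: "0 \<le> cost s" for s using c by (simp add: cost_def)
  have cost_k: "cost s + cost t = k" if "s \<noteq> t" for s t using that by (auto simp: cost_def)
  have nn: "0 \<le> l" if "?W u w b l" for u w b l by (rule signed_walk_nonneg[OF that f])
  define once where "once a z b l \<longleftrightarrow> (\<exists>u w s b1 l1 b2 l2. {u, w} = {p, q} \<and> ?W a u b1 l1 \<and>
      ?W w z b2 l2 \<and> b = (s \<noteq> (b1 \<noteq> b2)) \<and> l1 + cost s + l2 \<le> l)" for a z b l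
  have inv: "0 \<le> l \<and> (k \<le> l \<or> (\<exists>l'\<le>l. ?W a z b l') \<or> once a z b l)"
    if "signed_walk ?E ?x k a z b l" for a z b l
    using that
  proof (induction rule: signed_walk.induct)
    case (Nil a)
    then show ?case using signed_walk.Nil by fastforce
  next
    case (Cons a a' z b l s)
    let ?l = "step_cost ?x k s {a, a'} + l"
    have l: "l \<le> ?l"
      using Cons.hyps(1) step_cost_nonneg[OF f] cost cost_nn old by (metis insertE le_add_same_cancel2)
    consider "k \<le> l" | (walk) l' where "l' \<le> l" "?W a' z b l'" | (once) "once a' z b l"
      using Cons.IH by blast
    then have "k \<le> ?l \<or> (\<exists>l'\<le>?l. ?W a z (s \<noteq> b) l') \<or> once a z (s \<noteq> b) ?l"
    proof cases
      case 1 then show ?thesis using l by linarith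
    next
      case (walk l')
      show ?thesis
      proof (cases "{a, a'} \<in> E")
        case True
        then have "?W a z (s \<noteq> b) (step_cost x k s {a, a'} + l')"
          using walk by (intro signed_walk.Cons)
        then show ?thesis using walk old[OF True] by (metis add_left_mono)
      next
        case False
        then have aa: "{a, a'} = {p, q}" using Cons.hyps(1) by blast
        have "once a z (s \<noteq> b) ?l"
          unfolding once_def using aa signed_walk.Nil[of E x k a] walk cost[of s]
          by (intro exI[of _ a] exI[of _ a'] exI[of _ s] exI[of _ False] exI[of _ 0] exI[of _ b] exI[of _ l']) simp
        then show ?thesis by blast
      qed
    next
      case once
      then obtain u w t b1 l1 b2 l2 where o: "{u, w} = {p, q}" "?W a' u b1 l1" "?W w z b2 l2"
          "b = (t \<noteq> (b1 \<noteq> b2))" "l1 + cost t + l2 \<le> l"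
        unfolding once_def by blast
      show ?thesis
      proof (cases "{a, a'} \<in> E")
        case True
        then have "?W a u (s \<noteq> b1) (step_cost x k s {a, a'} + l1)"
          using o(2) by (intro signed_walk.Cons)
        moreover have "(s \<noteq> b) = (t \<noteq> ((s \<noteq> b1) \<noteq> b2))" using o(4) by auto
        moreover have "(step_cost x k s {a, a'} + l1) + cost t + l2 \<le> ?l" using old[OF True] o(5) by simp
        ultimately show ?thesis unfolding once_def using o(1,3) by blast
      next
        case False
        then have aa: "{a, a'} = {p, q}" using Cons.hyps(1) by blast
        have l_eq: "?l = cost s + l" using aa cost by simp
        show ?thesis
        proof (cases "s = t")
          case neq: False
          then show ?thesis using cost_k[of s t] o nn[OF o(2)] nn[OF o(3)] l_eq by simp
        next
          case True
          have sb: "(s \<noteq> b) = (b1 \<noteq> b2)" using True o(4) by auto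
          have le: "l1 + l2 \<le> ?l" using o(5) l_eq cost_nn[of s] cost_nn[of t] by linarith
          \<comment> \<open>The first use of the new edge is the step \<open>a a'\<close>, the second one is \<open>u w\<close>.\<close>
          consider (return) "u = a'" "w = a" | (again) "u = a" "w = a'"
            using aa o(1) by (metis doubleton_eq_iff)
          then show ?thesis
          proof cases
            case again
            then have "?W a z (b1 \<noteq> b2) (l1 + l2)"
              using signed_walk_append[OF signed_walk_rev[OF o(2)]] o(3) by simp
            then show ?thesis unfolding sb using le by blast
          next
            case return
            show ?thesis
            proof (cases b1)
              case True
              then have "k \<le> l1" using f o(2) return by (auto simp: feasible_def)
              then show ?thesis using le nn[OF o(3)] by linarith
            next
              case False
              then have "?W a z (s \<noteq> b) l2" using o(3) return sb by simp
              then show ?thesis using le nn[OF o(2)] by (smt (verit))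
            qed
          qed
        qed
      qed
    qed
    moreover have "0 \<le> ?l" using Cons.IH l by linarith
    ultimately show ?case by blast
  qed
  have "k \<le> l" if closed: "signed_walk ?E ?x k a a True l" for a l
  proof -
    consider "k \<le> l" | (walk) l' where "l' \<le> l" "?W a a True l'" | (once) "once a a True l"
      using inv[OF closed] by blast
    then show ?thesis
    proof cases
      case walk
      then show ?thesis using f by (fastforce simp: feasible_def)
    next
      case once
      then obtain u w s b1 l1 b2 l2 where o: "{u, w} = {p, q}" "?W a u b1 l1" "?W w a b2 l2"
          "s = (b1 = b2)" "l1 + cost s + l2 \<le> l"
        unfolding once_def by blast
      have "?W w u (b2 \<noteq> b1) (l2 + l1)" using signed_walk_append[OF o(3) o(2)] .
      then have "?W p q (b2 \<noteq> b1) (l2 + l1)"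
        using o(1) signed_walk_rev by (metis doubleton_eq_iff)
      moreover have "(b2 \<noteq> b1) = (\<not> s)" using o(4) by auto
      ultimately have "?W p q (\<not> s) (l2 + l1)" by simp
      then have "k \<le> cost s + (l2 + l1)"
        using even[of "l2 + l1"] odd[of "l2 + l1"] by (cases s) (auto simp: cost_def)
      then show ?thesis using o(5) by linarith
    qed
  qed
  then show ?thesis using f c unfolding feasible_def by auto
qed

text \<open>Walks of sign \<open>False\<close> bound the new value from above and walks of sign \<open>True\<close> bound it from below; the two
kinds of bounds are compatible because together such walks form an odd closed walk. A cheapest walk
of either sign provides a value of the right parity, unless its cost exceeds \<open>k\<close>. If this happens for both
signs, or there is no walk at all, then \<open>0\<close> and \<open>1\<close> both respect the bounds. The hypothesis
\<open>1 \<le> k\<close> serves this case, where parity may force the value \<open>1\<close>.\<close>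

lemma feasible_value_exists:
  fixes E :: "'a set set"
  assumes f: "feasible E x k" and pot: "potential E x \<pi>" and k: "1 \<le> k"
  obtains c where "0 \<le> c" "c \<le> k" "odd c = (\<pi> p \<noteq> \<pi> q)"
    "\<And>l. signed_walk E x k p q False l \<Longrightarrow> c \<le> l"
    "\<And>l. signed_walk E x k p q True l \<Longrightarrow> k - c \<le> l"
proof -
  let ?W = "signed_walk E x k"
  have nn: "0 \<le> l" if "?W u w b l" for u w b l by (rule signed_walk_nonneg[OF that f])
  have par: "odd l = ((\<pi> u \<noteq> \<pi> w) \<noteq> (b \<and> odd k))" if "?W u w b l" for u w b l
    by (rule signed_walk_parity[OF that pot])
  have sum: "k \<le> l + l'" if "?W p q False l" "?W p q True l'" for l l'
    using f signed_walk_append[OF that(1) signed_walk_rev[OF that(2)]] by (simp add: feasible_def)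
  have shortest: "\<exists>l. ?W p q b l \<and> (\<forall>l'. ?W p q b l' \<longrightarrow> l \<le> l')" if "?W p q b l0" for b l0
    using ex_has_least_nat[of "?W p q b" l0 nat] that nn by (metis nat_le_eq_zle)
  consider (even) l where "?W p q False l" "l \<le> k"
    | (odd) l where "?W p q True l" "l \<le> k"
    | (far) "\<And>l b. ?W p q b l \<Longrightarrow> k < l"
    by (metis (full_types) not_le)
  then show ?thesis
  proof cases
    case even
    then obtain c where "?W p q False c" "\<And>l. ?W p q False l \<Longrightarrow> c \<le> l" "c \<le> k"
      using shortest by (meson order_trans)
    then show ?thesis using that[of c] nn par[of p q False c] sum[of c] by force
  next
    case odd
    then obtain d where d: "?W p q True d" "\<And>l. ?W p q True l \<Longrightarrow> d \<le> l" "d \<le> k"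
      using shortest by (meson order_trans)
    have "k - d \<le> l" if "?W p q False l" for l using sum[OF that d(1)] by linarith
    then show ?thesis using that[of "k - d"] d nn[OF d(1)] par[OF d(1)] by auto
  next
    case far
    let ?c = "if \<pi> p \<noteq> \<pi> q then 1 else 0 :: int"
    have c: "0 \<le> ?c" "?c \<le> k" "odd ?c = (\<pi> p \<noteq> \<pi> q)" using k by auto
    moreover have "?c \<le> l" if "?W p q False l" for l using far[OF that] c(2) by linarith
    moreover have "k - ?c \<le> l" if "?W p q True l" for l using far[OF that] c(1) by linarith
    ultimately show ?thesis by (rule that)
  qed
qed

lemma feasible_extend:
  fixes E :: "'a set set"
  assumes "finite F" "\<And>e. e \<in> F \<Longrightarrow> card e = 2" and f: "feasible E x k" "potential E x \<pi>" and k: "1 \<le> k"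
  obtains x' where "feasible (E \<union> F) x' k" "potential (E \<union> F) x' \<pi>" "\<And>e. e \<in> E \<Longrightarrow> x' e = x e"
proof -
  have "\<exists>x'. feasible (E \<union> F) x' k \<and> potential (E \<union> F) x' \<pi> \<and> (\<forall>e\<in>E. x' e = x e)"
    using assms(1,2)
  proof (induction rule: finite_induct)
    case empty then show ?case using f by auto
  next
    case (insert e F)
    then obtain y where y: "feasible (E \<union> F) y k" "potential (E \<union> F) y \<pi>" "\<forall>e\<in>E. y e = x e"
      by auto
    show ?case
    proof (cases "e \<in> E")
      case True
      then have "E \<union> Set.insert e F = E \<union> F" by blast
      then show ?thesis using y by metis
    next
      case False
      obtain p q where e: "e = {p, q}" using insert.prems by (metis card_2_iff insertI1)
      have new: "{p, q} \<notin> E \<union> F" using False insert.hyps e by blast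
      obtain c where c: "0 \<le> c" "c \<le> k" "odd c = (\<pi> p \<noteq> \<pi> q)"
          "\<And>l. signed_walk (E \<union> F) y k p q False l \<Longrightarrow> c \<le> l"
          "\<And>l. signed_walk (E \<union> F) y k p q True l \<Longrightarrow> k - c \<le> l"
        using feasible_value_exists[OF y(1,2) k] by blast
      have "feasible (E \<union> Set.insert e F) (y(e := c)) k"
        using feasible_insert[OF y(1) c(1,2,4,5) new] e by simp
      moreover have "potential (E \<union> Set.insert e F) (y(e := c)) \<pi>"
        
        unfolding potential_def
      proof (intro allI impI)
        fix u w assume uw: "{u, w} \<in> E \<union> Set.insert e F"
        show "odd ((y(e := c)) {u, w}) = (\<pi> u \<noteq> \<pi> w)"
        proof (cases "{u, w} = e")
          case True
          then have "(\<pi> u \<noteq> \<pi> w) = (\<pi> p \<noteq> \<pi> q)"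
            unfolding e doubleton_eq_iff by auto
          then show ?thesis using True c(3) by simp
        next
          case False
          then have "(y(e := c)) {u, w} = y {u, w}" "{u, w} \<in> E \<union> F" using uw by auto
          then show ?thesis using y(2) unfolding potential_def by metis
        qed
      qed
      moreover have "\<forall>e'\<in>E. (y(e := c)) e' = x e'" using y(3) False by auto
      ultimately show ?thesis by blast
    qed
  qed
  then show ?thesis using that by blast
qed

section \<open>Decomposition into cuts\<close>

text \<open>The prescribed sizes force \<open>|Z \<inter> B| = \<beta>\<close> and \<open>|Z \<inter> C| = \<gamma>\<close>, where \<open>2 \<beta> = p + n - r\<close> and \<open>2 \<gamma> = q + n - s\<close>.
Once \<open>t = |Z \<inter> B \<inter> C|\<close> is chosen, the numbers of elements of \<open>Z\<close> in the four regions cut out by \<open>B\<close> and \<open>C\<close> are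
\<open>t\<close>, \<open>\<beta> - t\<close>, \<open>\<gamma> - t\<close> and \<open>n - \<beta> - \<gamma> + t\<close>. Each of them must be between zero and the size of its region. This
leaves four lower and four upper bounds for \<open>t\<close>, and each of the sixteen comparisons between them is a triangle
inequality or the nonnegativity of the size of a region.\<close>

lemma exists_subset_with_distances:
  fixes K B C :: "'b set" and n r s :: int
  assumes K: "finite K" "B \<subseteq> K" "C \<subseteq> K"
    and p: "int (card B) = p" and q: "int (card C) = q" and d: "int (card (sym_diff B C)) = d"
    and k: "int (card K) = k"
    and tri_B: "p \<le> n + r" "n \<le> p + r" "r \<le> p + n" "p + n + r \<le> 2 * k"
    and tri_C: "q \<le> n + s" "n \<le> q + s" "s \<le> q + n" "q + n + s \<le> 2 * k"
    and tri_BC: "d \<le> r + s" "r \<le> d + s" "s \<le> d + r" "d + r + s \<le> 2 * k"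
    and even: "even (p + n + r)" "even (q + n + s)"
  obtains Z where "Z \<subseteq> K" "int (card Z) = n" "int (card (sym_diff Z B)) = r"
    "int (card (sym_diff Z C)) = s"
proof -
  define m where "m = int (card (B \<inter> C))"
  have fin: "finite B" "finite C" using K finite_subset by auto
  have B: "p = m + int (card (B - C))"
    using card_Int_Diff[OF fin(1), of C] p by (simp add: m_def)
  have C: "q = m + int (card (C - B))"
    using card_Int_Diff[OF fin(2), of B] q by (simp add: m_def Int_commute)
  have D: "d = p + q - 2 * m"
  proof -
    have "card (sym_diff B C) = card (B - C) + card (C - B)"
      using fin by (intro card_Un_disjoint) auto
    then show ?thesis using d B C by simp
  qed
  have O: "int (card (K - (B \<union> C))) = k - p - q + m"
  proof -
    have "card (B \<union> C) + card (B \<inter> C) = card B + card C" using card_Un_Int[OF fin] by simp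
    moreover have "card (K - (B \<union> C)) + card (B \<union> C) = card K"
      using K fin by (metis Un_least card_Diff_subset card_mono finite_UnI le_add_diff_inverse2)
    ultimately show ?thesis using p q k by (simp add: m_def)
  qed
  have regions: "0 \<le> m" "m \<le> p" "m \<le> q" "0 \<le> k - p - q + m"
    using B C O m_def by linarith+
  obtain \<beta> where \<beta>: "p + n - r = 2 * \<beta>" using even(1) by (metis even_add even_diff evenE)
  obtain \<gamma> where \<gamma>: "q + n - s = 2 * \<gamma>" using even(2) by (metis even_add even_diff evenE)
  have bounds_B: "0 \<le> \<beta>" "\<beta> \<le> p" "\<beta> \<le> n" "p + n - \<beta> \<le> k"
    using tri_B \<beta> by linarith+
  have bounds_C: "0 \<le> \<gamma>" "\<gamma> \<le> q" "\<gamma> \<le> n" "q + n - \<gamma> \<le> k"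
    using tri_C \<gamma> by linarith+
  have bounds_BC: "\<beta> + \<gamma> - n \<le> m" "\<gamma> - q + m \<le> \<beta>" "\<beta> - p + m \<le> \<gamma>"
      "p + q + n - m - \<beta> - \<gamma> \<le> k"
    using tri_BC \<beta> \<gamma> D by linarith+
  \<comment> \<open>The largest of the four lower bounds for the size of the triple intersection.\<close>
  define t where "t = max (max 0 (\<beta> - p + m)) (max (\<gamma> - q + m) (\<beta> + \<gamma> - n))"
  have lower: "0 \<le> t" "\<beta> - p + m \<le> t" "\<gamma> - q + m \<le> t" "\<beta> + \<gamma> - n \<le> t"
    unfolding t_def by auto
  have least: "t \<le> i" if "0 \<le> i" "\<beta> - p + m \<le> i" "\<gamma> - q + m \<le> i" "\<beta> + \<gamma> - n \<le> i" for i
    unfolding t_def using that by simp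
  have upper: "t \<le> m" "t \<le> \<beta>" "t \<le> \<gamma>" "t \<le> k - p - q + m - n + \<beta> + \<gamma>"
    by (rule least; use regions bounds_B bounds_C bounds_BC in linarith)+
  have part: "\<exists>T\<subseteq>R. int (card T) = i" if "0 \<le> i" "i \<le> int (card R)" for R :: "'b set" and i
  proof -
    have "nat i \<le> card R" using that by linarith
    then obtain T where "T \<subseteq> R" "card T = nat i" by (rule obtain_subset_with_card_n)
    then show ?thesis using that(1) by (intro exI[of _ T]) simp
  qed
  obtain Z1 where Z1: "Z1 \<subseteq> B \<inter> C" "int (card Z1) = t"
    using part[of t "B \<inter> C"] lower upper m_def by auto
  obtain Z2 where Z2: "Z2 \<subseteq> B - C" "int (card Z2) = \<beta> - t"
    using part[of "\<beta> - t" "B - C"] lower upper B by auto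
  obtain Z3 where Z3: "Z3 \<subseteq> C - B" "int (card Z3) = \<gamma> - t"
    using part[of "\<gamma> - t" "C - B"] lower upper C by auto
  obtain Z4 where Z4: "Z4 \<subseteq> K - (B \<union> C)" "int (card Z4) = n - \<beta> - \<gamma> + t"
    using part[of "n - \<beta> - \<gamma> + t" "K - (B \<union> C)"] lower upper O by auto
  define Z where "Z = Z1 \<union> Z2 \<union> Z3 \<union> Z4"
  have ZK: "Z \<subseteq> K" using Z1 Z2 Z3 Z4 K unfolding Z_def by blast
  have finZ: "finite Z" using ZK K(1) finite_subset by blast
  then have finZ': "finite Z1" "finite Z2" "finite Z3" "finite Z4" by (auto simp: Z_def)
  have un: "int (card (X \<union> Y)) = int (card X) + int (card Y)" if "finite X" "finite Y" "X \<inter> Y = {}" for X Y :: "'b set"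
    using card_Un_disjoint[OF that] by simp
  have ZB: "int (card (Z \<inter> B)) = \<beta>"
  proof -
    have "Z \<inter> B = Z1 \<union> Z2" using Z1 Z2 Z3 Z4 unfolding Z_def by blast
    moreover have "Z1 \<inter> Z2 = {}" using Z1 Z2 by blast
    ultimately show ?thesis using un finZ' Z1 Z2 by simp
  qed
  have ZC: "int (card (Z \<inter> C)) = \<gamma>"
  proof -
    have "Z \<inter> C = Z1 \<union> Z3" using Z1 Z2 Z3 Z4 unfolding Z_def by blast
    moreover have "Z1 \<inter> Z3 = {}" using Z1 Z3 by blast
    ultimately show ?thesis using un finZ' Z1 Z3 by simp
  qed
  have Zn: "int (card Z) = n"
  proof -
    have "(Z1 \<union> Z2) \<inter> (Z3 \<union> Z4) = {}" "Z1 \<inter> Z2 = {}" "Z3 \<inter> Z4 = {}"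
      using Z1 Z2 Z3 Z4 by blast+
    then have "int (card ((Z1 \<union> Z2) \<union> (Z3 \<union> Z4))) = n"
      using un finZ' Z1 Z2 Z3 Z4 by simp
    then show ?thesis by (simp add: Z_def Un_assoc)
  qed
  have dist: "int (card (sym_diff Z Y)) = int (card Z) + int (card Y) - 2 * int (card (Z \<inter> Y))"
    if "finite Y" for Y
  proof -
    have "card Z = card (Z \<inter> Y) + card (Z - Y)" "card Y = card (Z \<inter> Y) + card (Y - Z)"
      using card_Int_Diff[OF finZ, of Y] card_Int_Diff[OF that, of Z] by (simp_all add: Int_commute)
    moreover have "int (card (sym_diff Z Y)) = int (card (Z - Y)) + int (card (Y - Z))"
      using finZ that by (intro un) auto
    ultimately show ?thesis by simp
  qed
  show ?thesis
  proof (rule that[OF ZK Zn])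
    show "int (card (sym_diff Z B)) = r" using dist[OF fin(1)] ZB Zn p \<beta> by simp
    show "int (card (sym_diff Z C)) = s" using dist[OF fin(2)] ZC Zn q \<gamma> by simp
  qed
qed

lemma simple_graph_induced:
  "simple_graph V E \<Longrightarrow> W \<subseteq> V \<Longrightarrow> simple_graph W (induced_edges E W)"
  unfolding simple_graph_def induced_edges_def using finite_subset by auto

lemma sym_diff_sym_diff: "sym_diff (sym_diff X Z) (sym_diff Y Z) = sym_diff X Y"
  by blast

text \<open>The sets \<open>A u\<close> encode \<open>k\<close> cuts at once: the \<open>i\<close>-th cut consists of the vertices \<open>u\<close> with \<open>i \<in> A u\<close>, and
\<open>A u\<close> and \<open>A w\<close> differ in exactly those \<open>i\<close> whose cut contains the edge \<open>uw\<close>. A vertex \<open>a \<noteq> v\<close> of degree at most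
two in the graph without \<open>v\<close> is removed after all pairs in \<open>{v, a, b, c}\<close> have been given values.\<close>

lemma cut_decomposition_pos:
  fixes V :: "'a set"
  assumes "simple_graph V E" "v \<in> V"
    and "\<not> has_complete_minor 4 (V - {v}) (induced_edges E (V - {v}))"
    and "feasible E x k" "potential E x \<pi>" and k: "1 \<le> k"
  shows "\<exists>A :: 'a \<Rightarrow> nat set. (\<forall>u. A u \<subseteq> {..<nat k}) \<and>
    (\<forall>u w. {u, w} \<in> E \<longrightarrow> int (card (sym_diff (A u) (A w))) = x {u, w})"
  using assms(1-5)
proof (induction "card V" arbitrary: V E x rule: less_induct)
  case less
  note sg = less.prems(1) and v = less.prems(2) and free = less.prems(3)
  have fin: "finite V" using sg by (simp add: simple_graph_def)
  show ?case
  proof (cases "V - {v} = {}")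
    case True
    then have "e \<notin> E" for e
      using sg card_mono[of "{v}" e] unfolding simple_graph_def by fastforce
    then show ?thesis by (intro exI[of _ "\<lambda>_. {}"]) auto
  next
    case False
    let ?H = "induced_edges E (V - {v})"
    have sgH: "simple_graph (V - {v}) ?H" using simple_graph_induced[OF sg] by blast
    obtain a N where a: "a \<in> V - {v}" and N: "N \<subseteq> V - {v} - {a}" "nbrs ?H a = N" "card N \<le> 2"
      and freeN: "\<not> has_complete_minor 4 (V - {v} - {a})
        (induced_edges ?H (V - {v} - {a}) \<union> {e. e \<subseteq> N \<and> card e = 2})"
      by (rule degree_2_reduction[OF sgH False free])
    have finN: "finite N" using N(1) fin finite_subset by blast
    \<comment> \<open>Missing neighbours of \<open>a\<close> are replaced by \<open>v\<close>, so that one argument covers all degrees.\<close>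
    obtain b c where bc: "N \<subseteq> {b, c}" "{b, c} \<subseteq> insert v N"
    proof -
      consider "card N = 0" | "card N = 1" | "card N = 2" using N(3) by linarith
      then show ?thesis
      proof cases
        case 1 then show ?thesis using that[of v v] finN by simp
      next
        case 2 then show ?thesis using that[of _ v] by (auto simp: card_1_singleton_iff)
      next
        case 3 then show ?thesis using that by (auto simp: card_2_iff)
      qed
    qed
    let ?Q = "{v, a, b, c}"
    define F where "F = {e. e \<subseteq> ?Q \<and> card e = 2}"
    have Q: "?Q \<subseteq> V" "a \<notin> {v, b, c}" using a N(1) bc v by auto
    have finF: "finite F" unfolding F_def by (rule finite_subset[of _ "Pow ?Q"]) auto
    have "\<And>e. e \<in> F \<Longrightarrow> card e = 2" by (simp add: F_def)
    then obtain x' where x': "feasible (E \<union> F) x' k" "potential (E \<union> F) x' \<pi>"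
        "\<And>e. e \<in> E \<Longrightarrow> x' e = x e"
      using feasible_extend[OF finF _ less.prems(4,5) k] by blast
    let ?W = "V - {a}"
    let ?E2 = "induced_edges (E \<union> F) ?W"
    have "simple_graph V (E \<union> F)" using sg Q(1) unfolding simple_graph_def F_def by auto
    then have sg2: "simple_graph ?W ?E2" using simple_graph_induced by blast
    have v2: "v \<in> ?W" using v a by blast
    have "induced_edges ?E2 (?W - {v}) =
        induced_edges ?H (V - {v} - {a}) \<union> {e. e \<subseteq> N \<and> card e = 2}"
    proof (intro subset_antisym subsetI)
      fix e assume "e \<in> induced_edges ?E2 (?W - {v})"
      then have e: "e \<in> E \<or> e \<subseteq> ?Q \<and> card e = 2" "e \<subseteq> V - {v} - {a}"
        unfolding induced_edges_def F_def by auto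
      then have "e \<in> E \<or> e \<subseteq> N \<and> card e = 2" using bc(2) by blast
      then show "e \<in> induced_edges ?H (V - {v} - {a}) \<union> {e. e \<subseteq> N \<and> card e = 2}"
        using e(2) unfolding induced_edges_def by blast
    next
      fix e assume "e \<in> induced_edges ?H (V - {v} - {a}) \<union> {e. e \<subseteq> N \<and> card e = 2}"
      then have "e \<in> E \<and> e \<subseteq> V - {v} - {a} \<or> e \<subseteq> N \<and> card e = 2"
        unfolding induced_edges_def by blast
      then show "e \<in> induced_edges ?E2 (?W - {v})"
        using bc(1) N(1) unfolding induced_edges_def F_def by blast
    qed
    moreover have "?W - {v} = V - {v} - {a}" by blast
    ultimately have free2: "\<not> has_complete_minor 4 (?W - {v}) (induced_edges ?E2 (?W - {v}))"
      using freeN by simp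
    have sub: "?E2 \<subseteq> E \<union> F" unfolding induced_edges_def by blast
    have "card ?W < card V" using fin a by (intro card_Diff1_less) auto
    moreover have "potential ?E2 x' \<pi>" using x'(2) sub unfolding potential_def by blast
    ultimately obtain A0 :: "'a \<Rightarrow> nat set" where A0: "\<And>u. A0 u \<subseteq> {..<nat k}"
        "\<And>u w. {u, w} \<in> ?E2 \<Longrightarrow> int (card (sym_diff (A0 u) (A0 w))) = x' {u, w}"
      using less.hyps[OF _ sg2 v2 free2 feasible_subset[OF x'(1) sub]] by blast
    \<comment> \<open>Exchanging the sides of a cut does not change it, so \<open>v\<close> may be put outside every cut.\<close>
    define A1 where "A1 u = sym_diff (A0 u) (A0 v)" for u
    have A1: "A1 u \<subseteq> {..<nat k}" "A1 v = {}" for u using A0(1) unfolding A1_def by blast+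
    have A1_dist: "int (card (sym_diff (A1 u) (A1 w))) = x' {u, w}" if "{u, w} \<in> ?E2" for u w
      unfolding A1_def sym_diff_sym_diff using A0(2)[OF that] .
    \<comment> \<open>Setting the value to zero on the diagonal admits coincidences among \<open>v\<close>, \<open>b\<close> and \<open>c\<close>.\<close>
    define y where "y u w = (if u = w then 0 else x' {u, w})" for u w
    have edge: "{u, w} \<in> E \<union> F" if "u \<noteq> w" "u \<in> ?Q" "w \<in> ?Q" for u w
      using that unfolding F_def by auto
    have y_sym: "y u w = y w u" for u w by (simp add: y_def insert_commute)
    have y_bd: "0 \<le> y u w \<and> y u w \<le> k" if "u \<in> ?Q" "w \<in> ?Q" for u w
      using x'(1) edge[of u w] that k unfolding feasible_def y_def by auto
    have y_par: "odd (y u w) = (\<pi> u \<noteq> \<pi> w)" if "u \<in> ?Q" "w \<in> ?Q" for u w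
      using x'(2) edge[of u w] that unfolding potential_def y_def by auto
    have tri: "y p q \<le> y r p + y r q \<and> y r p \<le> y p q + y r q \<and> y r q \<le> y p q + y r p \<and>
        y p q + y r p + y r q \<le> 2 * k" if Q: "p \<in> ?Q" "q \<in> ?Q" "r \<in> ?Q" for p q r
    proof (cases "p = q \<or> q = r \<or> p = r")
      case True
      have "y u u = 0" for u by (simp add: y_def)
      then show ?thesis
        using True y_bd[OF Q(1,2)] y_bd[OF Q(2,3)] y_bd[OF Q(1,3)] y_sym[of r p] y_sym[of r q]
        by (elim disjE) simp_all
    next
      case False
      have one: "y u w \<le> y u t + y t w" "y u t + y t w + y u w \<le> 2 * k"
        if "u \<noteq> t" "t \<noteq> w" "u \<noteq> w" "u \<in> ?Q" "t \<in> ?Q" "w \<in> ?Q" for u t w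
        using feasible_triangle[OF x'(1) edge[OF that(1,4,5)] edge[OF that(2,5,6)] edge[OF that(3,4,6)]] that
        by (simp_all add: y_def)
      show ?thesis
        using one[of p r q] one(1)[of r q p] one(1)[of r p q] False Q y_sym[of r p] y_sym[of q p] y_sym[of q r]
        by (simp add: eq_commute)
    qed
    have A1_y: "int (card (sym_diff (A1 u) (A1 w))) = y u w" if "u \<in> {v, b, c}" "w \<in> {v, b, c}" for u w
    proof (cases "u = w")
      case True then show ?thesis by (simp add: y_def)
    next
      case False
      have "{u, w} \<in> ?E2" using edge[OF False] that Q unfolding induced_edges_def by auto
      then show ?thesis using A1_dist False by (simp add: y_def)
    qed
    have inQ: "v \<in> ?Q" "a \<in> ?Q" "b \<in> ?Q" "c \<in> ?Q" by auto
    obtain Z where Z: "Z \<subseteq> {..<nat k}" "int (card Z) = y a v"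
        "int (card (sym_diff Z (A1 b))) = y a b" "int (card (sym_diff Z (A1 c))) = y a c"
    proof (rule exists_subset_with_distances[of "{..<nat k}" "A1 b" "A1 c" "y v b" "y v c" "y b c" k
          "y a v" "y a b" "y a c"])
      show "int (card (A1 b)) = y v b" using A1_y[of v b] A1(2) by simp
      show "int (card (A1 c)) = y v c" using A1_y[of v c] A1(2) by simp
      show "int (card (sym_diff (A1 b) (A1 c))) = y b c" using A1_y by simp
      show "int (card {..<nat k}) = k" using k by simp
      show "even (y v b + y a v + y a b)" "even (y v c + y a v + y a c)"
        using y_par[OF inQ(1,3)] y_par[OF inQ(1,4)] y_par[OF inQ(2,1)] y_par[OF inQ(2,3)] y_par[OF inQ(2,4)]
        by (simp_all, argo+)
    qed (use A1(1) tri[OF inQ(1,3,2)] tri[OF inQ(1,4,2)] tri[OF inQ(3,4,2)] in \<open>simp_all\<close>)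
    define A where "A = A1(a := Z)"
    have at_a: "int (card (sym_diff Z (A1 w))) = x {a, w} \<and> w \<noteq> a" if e: "{a, w} \<in> E" for w
    proof -
      have w: "w \<noteq> a" "w \<in> V" using sg e unfolding simple_graph_def by fastforce+
      have "w \<in> {v, b, c}"
      proof (cases "w = v")
        case False
        then have "w \<in> nbrs ?H a" using w e a unfolding nbrs_def induced_edges_def by auto
        then show ?thesis using N(2) bc by blast
      qed simp
      then have "int (card (sym_diff Z (A1 w))) = y a w" using Z A1(2) by auto
      then show ?thesis using w x'(3)[OF e] by (simp add: y_def)
    qed
    have "int (card (sym_diff (A u) (A w))) = x {u, w}" if e: "{u, w} \<in> E" for u w
    proof -
      consider (left) "u = a" | (right) "w = a" | (neither) "u \<noteq> a" "w \<noteq> a" by blast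
      then show ?thesis
      proof cases
        case left then show ?thesis using at_a[of w] e by (simp add: A_def)
      next
        case right
        then have "{a, u} \<in> E" using e by (simp add: insert_commute)
        from at_a[OF this] show ?thesis using right by (simp add: A_def insert_commute Un_commute)
      next
        case neither
        have "{u, w} \<subseteq> V" using sg e unfolding simple_graph_def by blast
        then have "{u, w} \<in> ?E2" using e neither unfolding induced_edges_def by auto
        then show ?thesis using A1_dist x'(3)[OF e] neither by (simp add: A_def)
      qed
    qed
    moreover have "A u \<subseteq> {..<nat k}" for u using A1(1) Z(1) by (simp add: A_def)
    ultimately show ?thesis by blast
  qed
qed

lemma cut_decomposition:
  fixes V :: "'a set"
  assumes "simple_graph V E" "v \<in> V"
    and "\<not> has_complete_minor 4 (V - {v}) (induced_edges E (V - {v}))"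
    and f: "feasible E x k" "potential E x \<pi>" and k: "0 \<le> k"
  obtains A :: "'a \<Rightarrow> nat set" where "\<And>u. A u \<subseteq> {..<nat k}"
    "\<And>u w. {u, w} \<in> E \<Longrightarrow> int (card (sym_diff (A u) (A w))) = x {u, w}"
proof (cases "k = 0")
  case True
  have "x e = 0" if "e \<in> E" for e using f(1) that True unfolding feasible_def by force
  then show ?thesis by (intro that[of "\<lambda>_. {}"]) auto
next
  case False
  then show ?thesis using cut_decomposition_pos[OF assms(1-5)] k that by fastforce
qed

section \<open>Normality of the cut polytope\<close>

lemma cut_vector_edge:
  assumes "{u, w} \<in> E" "u \<noteq> w"
  shows "cut_vector E S {u, w} = of_bool ((u \<in> S) \<noteq> (w \<in> S))"
proof -
  have "S \<inter> {u, w} = (if u \<in> S then {u} else {}) \<union> (if w \<in> S then {w} else {})" by auto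
  then show ?thesis using assms by (auto simp: cut_vector_def)
qed

text \<open>For a single cut and \<open>k = 1\<close>, a step costs \<open>1\<close> exactly if its kind disagrees with whether the edge crosses the
cut. A walk whose sign disagrees with whether its ends are separated therefore has a step of cost
\<open>1\<close>. The bound is the combination of these with nonnegative weights \<open>d\<close>; for an odd closed walk it says that the cost is at least \<open>k\<close>.\<close>

lemma signed_walk_cut_bound:
  fixes d :: "'s \<Rightarrow> real" and S :: "'s \<Rightarrow> 'a set"
  assumes "signed_walk E x k u w b l"
    and d: "\<And>z. z \<in> X \<Longrightarrow> 0 \<le> d z"
    and x: "\<And>u w. {u, w} \<in> E \<Longrightarrow> of_int (x {u, w}) = (\<Sum>z\<in>X. d z * of_bool ((u \<in> S z) \<noteq> (w \<in> S z)))"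
    and k: "of_int k = (\<Sum>z\<in>X. d z)"
  shows "(\<Sum>z\<in>X. d z * of_bool (b \<noteq> ((u \<in> S z) \<noteq> (w \<in> S z)))) \<le> of_int l"
  using assms(1)
proof (induction rule: signed_walk.induct)
  case (Nil u) then show ?case by simp
next
  case (Cons u w y b l s)
  let ?f = "\<lambda>s u w z. of_bool (s \<noteq> ((u \<in> S z) \<noteq> (w \<in> S z))) :: real"
  have cost: "of_int (step_cost x k s {u, w}) = (\<Sum>z\<in>X. d z * ?f s u w z)"
  proof (cases s)
    case True
    have "of_int (k - x {u, w}) = (\<Sum>z\<in>X. d z - d z * of_bool ((u \<in> S z) \<noteq> (w \<in> S z)))"
      using x[OF Cons.hyps(1)] k by (simp add: sum_subtractf)
    also have "\<dots> = (\<Sum>z\<in>X. d z * ?f True u w z)" by (intro sum.cong) auto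
    finally show ?thesis using True by (simp add: step_cost_def)
  next
    case False
    then show ?thesis using x[OF Cons.hyps(1)] by (simp add: step_cost_def)
  qed
  have "(\<Sum>z\<in>X. d z * ?f (s \<noteq> b) u y z) \<le> (\<Sum>z\<in>X. d z * ?f s u w z + d z * ?f b w y z)"
  proof (rule sum_mono)
    fix z assume "z \<in> X"
    moreover have "?f (s \<noteq> b) u y z \<le> ?f s u w z + ?f b w y z" by auto
    ultimately show "d z * ?f (s \<noteq> b) u y z \<le> d z * ?f s u w z + d z * ?f b w y z"
      using d by (metis distrib_left mult_left_mono)
  qed
  also have "\<dots> \<le> of_int (step_cost x k s {u, w} + l)"
    using cost Cons.IH by (simp add: sum.distrib)
  finally show ?case .
qed

text \<open>Modulo 2, an integer combination of cuts is the cut of the symmetric difference of the sets that have odd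
coefficients.\<close>

lemma potential_of_cuts:
  fixes c :: "'s \<Rightarrow> int" and S :: "'s \<Rightarrow> 'a set"
  assumes "\<And>u w. {u, w} \<in> E \<Longrightarrow> x {u, w} = (\<Sum>z\<in>X. c z * of_bool ((u \<in> S z) \<noteq> (w \<in> S z)))"
  shows "potential E x (\<lambda>u. odd (\<Sum>z\<in>X. c z * of_bool (u \<in> S z)))"
  unfolding potential_def
proof (intro allI impI)
  fix u w assume e: "{u, w} \<in> E"
  let ?s = "\<lambda>u. \<Sum>z\<in>X. c z * of_bool (u \<in> S z)"
  have "x {u, w} = (\<Sum>z\<in>X. c z * of_bool (u \<in> S z) + c z * of_bool (w \<in> S z)
      - 2 * (c z * of_bool (u \<in> S z \<and> w \<in> S z)))"
    unfolding assms[OF e] by (intro sum.cong) auto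
  also have "\<dots> = ?s u + ?s w - 2 * (\<Sum>z\<in>X. c z * of_bool (u \<in> S z \<and> w \<in> S z))"
    by (simp add: sum.distrib sum_subtractf sum_distrib_left)
  finally show "odd (x {u, w}) = (odd (?s u) \<noteq> odd (?s w))" by simp
qed

lemma lin_combs_Nats_sum:
  assumes "finite X" "finite I" "\<And>i. i \<in> I \<Longrightarrow> g i \<in> X"
  shows "(\<lambda>j. \<Sum>i\<in>I. g i j) \<in> lin_combs \<nat> X"
proof -
  have regroup: "(\<Sum>i\<in>I. g i j) = (\<Sum>z\<in>X. real (card {i \<in> I. g i = z}) * z j)" for j
  proof -
    have "(\<Sum>i\<in>I. g i j) = (\<Sum>z\<in>X. \<Sum>i\<in>{i \<in> I. g i = z}. g i j)"
      using assms by (intro sum.group[symmetric]) auto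
    also have "\<dots> = (\<Sum>z\<in>X. \<Sum>i\<in>{i \<in> I. g i = z}. z j)"
      by (intro sum.cong) auto
    finally show ?thesis by simp
  qed
  from regroup have "(\<lambda>j. \<Sum>i\<in>I. g i j) = (\<lambda>j. \<Sum>z\<in>X. real (card {i \<in> I. g i = z}) * z j)"
    by (rule ext)
  moreover have "\<forall>z\<in>X. real (card {i \<in> I. g i = z}) \<in> \<nat>" by simp
  ultimately show ?thesis unfolding lin_combs_def by (intro CollectI exI conjI)
qed

lemma lin_combs_mono:
  assumes "C \<subseteq> D"
  shows "lin_combs C X \<subseteq> lin_combs D X"
proof
  fix y assume "y \<in> lin_combs C X"
  then obtain c where "y = (\<lambda>i. \<Sum>x\<in>X. c x * x i)" "\<forall>x\<in>X. c x \<in> C"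
    unfolding lin_combs_def by (elim CollectE exE conjE)
  then show "y \<in> lin_combs D X"
    unfolding lin_combs_def using assms by (intro CollectI exI[of _ c] conjI) auto
qed

theorem corollary3p6:
  fixes V :: "'a set" and E :: "'a set set" and v :: 'a
  assumes "simple_graph V E"
    and "v \<in> V"
    and "\<not> has_complete_minor 4 (V - {v}) (induced_edges E (V - {v}))"
  shows "normal_cut_polytope V E"
proof -
  have fin: "finite V" using assms(1) by (simp add: simple_graph_def)
  define X where "X = cut_configuration V E"
  have finX: "finite X" unfolding X_def using fin by (rule finite_cut_configuration)
  have edgeE: "\<exists>u w. e = {u, w}" if "e \<in> E" for e
  proof -
    have "card e = 2" using assms(1) that by (simp add: simple_graph_def)
    then show ?thesis unfolding card_2_iff by (elim exE conjE) (intro exI)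
  qed
  have edge_neq: "u \<noteq> w" if "{u, w} \<in> E" for u w
  proof
    assume "u = w"
    moreover have "card {u, w} = 2" using assms(1) that unfolding simple_graph_def by blast
    ultimately show False by simp
  qed
  have "\<forall>z\<in>X. \<exists>S. S \<subseteq> V \<and> z = homogenize (cut_vector E S)"
    unfolding X_def cut_configuration_def cut_vectors_def by blast
  then obtain S where S: "\<And>z. z \<in> X \<Longrightarrow> z = homogenize (cut_vector E (S z))"
    by metis
  have z_None: "z None = 1" if "z \<in> X" for z
    by (subst S[OF that]) (simp add: homogenize_def)
  have z_Some: "z (Some e) = cut_vector E (S z) e" if "z \<in> X" for z e
    by (subst S[OF that]) (simp add: homogenize_def)
  have z_edge: "z (Some {u, w}) = of_bool ((u \<in> S z) \<noteq> (w \<in> S z))" if "z \<in> X" "{u, w} \<in> E" for z u w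
    using z_Some[OF that(1)] cut_vector_edge[OF that(2) edge_neq[OF that(2)]] by simp
  have "lin_combs \<nat> X = lin_combs \<int> X \<inter> lin_combs {q \<in> \<rat>. 0 \<le> q} X"
  proof (intro subset_antisym Int_greatest subsetI)
    fix y assume "y \<in> lin_combs \<int> X \<inter> lin_combs {q \<in> \<rat>. 0 \<le> q} X"
    then have "y \<in> lin_combs \<int> X" "y \<in> lin_combs {q \<in> \<rat>. 0 \<le> q} X" by blast+
    then obtain c d where cd: "\<forall>z\<in>X. c z \<in> \<int>" "\<forall>z\<in>X. d z \<in> {q \<in> \<rat>. 0 \<le> q}"
      and c: "y = (\<lambda>i. \<Sum>z\<in>X. c z * z i)" and d: "y = (\<lambda>i. \<Sum>z\<in>X. d z * z i)"
      unfolding lin_combs_def by (elim CollectE exE conjE) (rule that)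
    have d_nonneg: "0 \<le> d z" if "z \<in> X" for z using cd(2) that by simp
    define n where "n z = \<lfloor>c z\<rfloor>" for z
    have n: "of_int (n z) = c z" if "z \<in> X" for z using cd(1) that by (simp add: n_def)
    define k where "k = (\<Sum>z\<in>X. n z)"
    define x where "x e = (\<Sum>z\<in>X. n z * of_bool (e \<in> E \<and> card (S z \<inter> e) = 1))" for e
    have k_y: "of_int k = y None" unfolding k_def c of_int_sum
      by (intro sum.cong) (simp_all add: n z_None)
    have x_y: "of_int (x e) = y (Some e)" for e
      unfolding x_def c of_int_sum
      by (intro sum.cong) (simp_all add: n z_Some cut_vector_def)
    \<comment> \<open>The integer combination makes \<open>x\<close> and \<open>k\<close> integral; the rational one yields the inequalities.\<close>
    have k_d: "of_int k = (\<Sum>z\<in>X. d z)" unfolding k_y d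
      by (intro sum.cong) (simp_all add: z_None)
    have x_d: "of_int (x {u, w}) = (\<Sum>z\<in>X. d z * of_bool ((u \<in> S z) \<noteq> (w \<in> S z)))"
      if "{u, w} \<in> E" for u w
      unfolding x_y d using z_edge that by (intro sum.cong) auto
    have x_c: "x {u, w} = (\<Sum>z\<in>X. n z * of_bool ((u \<in> S z) \<noteq> (w \<in> S z)))" if "{u, w} \<in> E" for u w
    proof -
      have "(of_int (x {u, w}) :: real) = of_int (\<Sum>z\<in>X. n z * of_bool ((u \<in> S z) \<noteq> (w \<in> S z)))"
        unfolding x_y c of_int_sum using z_edge that by (intro sum.cong) (auto simp: n)
      then show ?thesis by (simp only: of_int_eq_iff)
    qed
    have "0 \<le> x e \<and> x e \<le> k" if e: "e \<in> E" for e
    proof -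
      obtain u w where uw: "e = {u, w}" using edgeE[OF e] by blast
      have "0 \<le> (of_int (x e) :: real)"
        unfolding uw x_d[OF e[unfolded uw]] using d_nonneg by (intro sum_nonneg) auto
      moreover have "(of_int (x e) :: real) \<le> of_int k"
        unfolding uw x_d[OF e[unfolded uw]] k_d using d_nonneg by (intro sum_mono) auto
      ultimately show ?thesis by simp
    qed
    moreover have "k \<le> l" if "signed_walk E x k u u True l" for u l
      using signed_walk_cut_bound[OF that d_nonneg x_d k_d] k_d by simp
    ultimately have feas: "feasible E x k" unfolding feasible_def by blast
    have "0 \<le> (of_int k :: real)" unfolding k_d using d_nonneg by (rule sum_nonneg)
    then have k0: "0 \<le> k" by simp
    have pot: "potential E x (\<lambda>u. odd (\<Sum>z\<in>X. n z * of_bool (u \<in> S z)))"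
      using x_c by (rule potential_of_cuts)
    obtain A :: "'a \<Rightarrow> nat set" where A: "\<And>u. A u \<subseteq> {..<nat k}"
        "\<And>u w. {u, w} \<in> E \<Longrightarrow> int (card (sym_diff (A u) (A w))) = x {u, w}"
      using cut_decomposition[OF assms feas pot k0] by blast
    define T where "T i = {u \<in> V. i \<in> A u}" for i
    define g where "g i = homogenize (cut_vector E (T i))" for i
    have gX: "g i \<in> X" for i
      unfolding g_def X_def cut_configuration_def cut_vectors_def T_def by blast
    have "y j = (\<Sum>i<nat k. g i j)" for j
    proof (cases j)
      case None
      then show ?thesis using k_y k0 by (simp add: g_def homogenize_def)
    next
      case (Some e)
      show ?thesis
      proof (cases "e \<in> E")
        case True
        then obtain u w where uw: "e = {u, w}" using edgeE by blast
        then have uwE: "{u, w} \<in> E" and uwV: "u \<in> V" "w \<in> V"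
          using True assms(1) unfolding simple_graph_def by auto
        have "(\<Sum>i<nat k. g i j) = (\<Sum>i<nat k. of_bool (i \<in> sym_diff (A u) (A w)))"
          unfolding g_def Some uw homogenize_def option.case cut_vector_edge[OF uwE edge_neq[OF uwE]]
          using uwV by (intro sum.cong) (auto simp: T_def)
        also have "\<dots> = real (card ({..<nat k} \<inter> sym_diff (A u) (A w)))"
          by (subst sum_of_bool_eq) (auto simp: Int_def)
        also have "{..<nat k} \<inter> sym_diff (A u) (A w) = sym_diff (A u) (A w)" using A(1) by blast
        also have "real (card (sym_diff (A u) (A w))) = of_int (x {u, w})"
          using A(2)[OF uwE] by (metis of_int_of_nat_eq)
        finally show ?thesis using x_y uw Some by simp
      next
        case False
        then show ?thesis
          unfolding Some d by (simp add: z_Some g_def homogenize_def cut_vector_def)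
      qed
    qed
    then have "y = (\<lambda>j. \<Sum>i<nat k. g i j)" by blast
    then show "y \<in> lin_combs \<nat> X" using lin_combs_Nats_sum[OF finX finite_lessThan gX] by simp
  next
    fix y assume y: "y \<in> lin_combs \<nat> X"
    show "y \<in> lin_combs \<int> X" using y lin_combs_mono[of \<nat> \<int> X] Nats_subset_Ints by blast
    have "\<nat> \<subseteq> {q \<in> \<rat>. 0 \<le> (q :: real)}" by (auto simp: Nats_def)
    then show "y \<in> lin_combs {q \<in> \<rat>. 0 \<le> q} X" using y lin_combs_mono by blast
  qed
  then show ?thesis unfolding normal_cut_polytope_def X_def Let_def by simp
qed

end
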